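(* Let $n\ge1$, $p,q>1$, let $\Theta\subset\mathbb{R}^{n+1}$ be open and bounded, and let $\xi_0=(x_0,t_0)\in\partial\Theta$. Suppose that there exist $\xi_1=(x_1,t_1)\in\mathbb{R}^{n+1}\setminus\Theta$ and a radius $R_1>0$ such that the Euclidean ball $B_{R_1}(\xi_1)\subset\mathbb{R}^{n+1}$ satisfies $B_{R_1}(\xi_1)\cap\Theta=\emptyset$ and $\xi_0\in\partial B_{R_1}(\xi_1)\cap\partial\Theta$. If $x_1\neq x_0$, then $\xi_0$ is regular with respect to $\Theta$ for the equation $\partial_t u=\Delta_p^q u$.
   Context: Equation. Points of $\mathbb{R}^{n+1}$ are written $(x,t)$, and $\nabla$, $\Delta$, $D^2$ act in $x$ only. The equation is (E): $\partial_t u=\Delta_p^q u$, where for $\nabla u\neq 0$, $\Delta_p^q u=|\nabla u|^{q-p}\operatorname{div}(|\nabla u|^{p-2}\nabla u)=F(\nabla u,D^2u)$ with $F(\eta,X)=|\eta|^{q-2}\operatorname{Tr}\big(X+(p-2)\tfrac{\eta\otimes\eta}{|\eta|^2}X\big)$ for $\eta\in\mathbb{R}^n\setminus\{0\}$ and $X$ a symmetric $n\times n$ matrix. Admissible functions. $\mathcal{F}(F)$ is the set of $f\in C^2([0,\infty))$ with $f(0)=f'(0)=f''(0)=0$, $f''(r)>0$ for all $r>0$, and $\lim_{x\to 0,\,x\ne 0}F(\nabla g(x),D^2g(x))=0$ for $g(x)=f(|x|)$. $\Sigma$ is the set of even $\sigma\in C^1(\mathbb{R})$ with $\sigma(0)=\sigma'(0)=0$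 and $\sigma(r)>0$ for $r>0$. A function $\varphi\in C^2(\Theta)$ is admissible at $(x_0,t_0)\in\Theta$ if either $\nabla\varphi(x_0,t_0)\ne0$, or there are $\delta>0$, $f\in\mathcal{F}(F)$, $\sigma\in\Sigma$ such that $|\varphi(x,t)-\varphi(x_0,t_0)-\partial_t\varphi(x_0,t_0)(t-t_0)|\le f(|x-x_0|)+\sigma(t-t_0)$ for all $(x,t)\in B_\delta(x_0)\times(t_0-\delta,t_0+\delta)$. Viscosity supersolutions. $u:\Theta\to\mathbb{R}\cup\{\infty\}$ is a viscosity supersolution of (E) in $\Theta$ if (1) $u$ is lower semicontinuous; (2) $u$ is finite in a dense subset of $\Theta$; (3) whenever $\varphi\in C^2(\Theta)$ is admissible at $\xi\in\Theta$ and touches $u$ at $\xi$ from below (i.e. $\varphi(\xi)=u(\xi)$ and $\varphi<u$ in a punctured neighborhood of $\xi$), then $\partial_t\varphi(\xi)-\Delta_p^q\varphi(\xi)\ge0$ if $\nabla\varphi(\xi)\ne0$, and $\partial_t\varphi(\xi)\ge0$ if $\nabla\varphi(\xi)=0$. Perron solutions and regularity. For bounded $f:\partial\Theta\to\mathbb{R}$, $\mathcal{U}_f$ is the class of viscosity supersolutions $u$ of (E) in $\Theta$ that are bounded from below and satisfy $\liminf_{\Theta\ni\eta\to\xi}u(\eta)\ge f(\xi)$ for all $\xi\in\partial\Theta$; the upper Perron solution is $\overline{H}f(\xi)=\inf_{u\in\mathcal{U}_f}u(\xi)$, $\xi\in\Theta$. A point $\xi_0\in\partial\Theta$ is regular (with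 respect to $\Theta$) if $\lim_{\Theta\ni\xi\to\xi_0}\overline{H}f(\xi)=f(\xi_0)$ for every $f\in C(\partial\Theta)$. *)

theory Defs
  imports "HOL-Analysis.Analysis"
begin

text \<open>
  A point of space-time is a pair \<open>(x, t)\<close> of type \<open>(real^'n) \<times> real\<close>; the norm of the product
  type is the Euclidean norm, so \<open>ball\<close> is the Euclidean ball of dimension \<open>CARD('n) + 1\<close>.
  Functions on a set are represented by total functions whose values off the set are irrelevant.
\<close>

section \<open>Differential operators\<close>

definition gradient :: "(real^'n \<Rightarrow> real) \<Rightarrow> real^'n \<Rightarrow> real^'n" where
  "gradient g x = (THE D. GDERIV g x :> D)"

definition hessian :: "(real^'n \<Rightarrow> real) \<Rightarrow> real^'n \<Rightarrow> real^'n^'n" where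
  "hessian g x = jacobian (gradient g) (at x)"

definition divergence :: "(real^'n \<Rightarrow> real^'n) \<Rightarrow> real^'n \<Rightarrow> real" where
  "divergence G x = trace (jacobian G (at x))"

definition tensor :: "real^'n \<Rightarrow> real^'n \<Rightarrow> real^'n^'n" where
  "tensor v w = (\<chi> i j. v $ i * w $ j)"

text \<open>These two are meaningful only for a nonzero gradient (respectively \<open>\<eta> \<noteq> 0\<close>).\<close>

definition pq_laplacian :: "real \<Rightarrow> real \<Rightarrow> (real^'n \<Rightarrow> real) \<Rightarrow> real^'n \<Rightarrow> real" where
  "pq_laplacian p q u x =
     norm (gradient u x) powr (q - p) *
     divergence (\<lambda>y. norm (gradient u y) powr (p - 2) *\<^sub>R gradient u y) x"

definition pq_F :: "real \<Rightarrow> real \<Rightarrow> real^'n \<Rightarrow> real^'n^'n \<Rightarrow> real" where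
  "pq_F p q \<eta> X =
     norm \<eta> powr (q - 2) *
     trace (X + (p - 2) *\<^sub>R (((1 / (norm \<eta>)\<^sup>2) *\<^sub>R tensor \<eta> \<eta>) ** X))"

lemma pq_laplacian_eq_pq_F:
  fixes u :: "real^'n \<Rightarrow> real"
  assumes d: "gradient u differentiable (at x)" and nz: "gradient u x \<noteq> 0"
  shows "pq_laplacian p q u x = pq_F p q (gradient u x) (hessian u x)"
proof -
  define G where "G = gradient u"
  define L where "L = frechet_derivative G (at x)"
  define N where "N = norm (G x)"
  have N: "N > 0" using nz by (simp add: N_def G_def)
  have dG: "(G has_derivative L) (at x)"
    using d by (simp add: G_def L_def frechet_derivative_works)
  have linL: "linear L" using dG by (rule has_derivative_linear)
  have dn: "((\<lambda>y. norm (G y)) has_derivative (\<lambda>h. L h \<bullet> sgn (G x))) (at x)"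
    using has_derivative_compose[OF dG has_derivative_norm] nz by (simp add: G_def)
  have dp: "((\<lambda>y. norm (G y) powr (p - 2)) has_derivative
      (\<lambda>h. (p - 2) * N powr (p - 3) * (L h \<bullet> sgn (G x)))) (at x)"
  proof -
    have "((\<lambda>s. s powr (p - 2)) has_real_derivative (p - 2) * N powr (p - 2 - 1)) (at N)"
      using N by (rule has_real_derivative_powr)
    then have "((\<lambda>s. s powr (p - 2)) has_derivative (\<lambda>h. (p - 2) * N powr (p - 3) * h)) (at N)"
      by (simp add: has_field_derivative_def)
    from has_derivative_compose[OF dn this[unfolded N_def]] show ?thesis
      by (simp add: N_def)
  qed
  have dV: "((\<lambda>y. norm (G y) powr (p - 2) *\<^sub>R G y) has_derivative
     (\<lambda>h. N powr (p - 2) *\<^sub>R L h + ((p - 2) * N powr (p - 3) * (L h \<bullet> sgn (G x))) *\<^sub>R G x)) (at x)"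
    using has_derivative_scaleR[OF dp dG] by (simp add: N_def)
  have "divergence (\<lambda>y. norm (G y) powr (p - 2) *\<^sub>R G y) x =
     (\<Sum>i\<in>UNIV. N powr (p - 2) * (L (axis i 1) $ i)
        + (p - 2) * N powr (p - 3) * (L (axis i 1) \<bullet> sgn (G x)) * G x $ i)"
    unfolding divergence_def jacobian_def frechet_derivative_at[OF dV, symmetric]
    by (simp add: trace_def matrix_def)
  also have "\<dots> = N powr (p - 2) * ((\<Sum>i\<in>UNIV. L (axis i 1) $ i)
        + (p - 2) * (\<Sum>i\<in>UNIV. (\<Sum>j\<in>UNIV. L (axis i 1) $ j * G x $ j) * G x $ i) / N\<^sup>2)"
  proof -
    have e: "N powr (p - 3) = N powr (p - 2) / N"
      using N by (simp add: powr_diff powr_numeral power2_eq_square power3_eq_cube)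
    have s: "L (axis i 1) \<bullet> sgn (G x) = (\<Sum>j\<in>UNIV. L (axis i 1) $ j * G x $ j) / N" for i
      by (simp add: sgn_div_norm N_def inner_vec_def divide_inverse sum_distrib_left mult_ac)
    have "(\<Sum>i\<in>UNIV. W * a i + c * (W / N) * (S i / N) * G x $ i)
        = W * ((\<Sum>i\<in>UNIV. a i) + c * (\<Sum>i\<in>UNIV. S i * G x $ i) / N\<^sup>2)"
      for W c :: real and a S :: "'n \<Rightarrow> real"
      by (simp add: sum.distrib sum_distrib_left sum_divide_distrib power2_eq_square
          distrib_left mult_ac)
    then show ?thesis unfolding e s .
  qed
  finally have div: "divergence (\<lambda>y. norm (G y) powr (p - 2) *\<^sub>R G y) x = \<dots>" .
  have tr: "trace (hessian u x + (p - 2) *\<^sub>R (((1 / N\<^sup>2) *\<^sub>R tensor (G x) (G x)) ** hessian u x))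
     = (\<Sum>i\<in>UNIV. L (axis i 1) $ i)
        + (p - 2) * (\<Sum>i\<in>UNIV. (\<Sum>j\<in>UNIV. L (axis i 1) $ j * G x $ j) * G x $ i) / N\<^sup>2"
    unfolding trace_def hessian_def jacobian_def G_def[symmetric] L_def[symmetric]
    by (simp add: matrix_def matrix_matrix_mult_def tensor_def sum.distrib
        sum_distrib_left sum_distrib_right sum_divide_distrib mult_ac)
  have "N powr (q - p) * N powr (p - 2) = N powr (q - 2)"
    by (simp flip: powr_add)
  then show ?thesis
    unfolding pq_laplacian_def pq_F_def G_def[symmetric] div tr[unfolded N_def] N_def[symmetric]
    by (metis (no_types, lifting) mult.assoc N_def tr)
qed

definition C2_on :: "'a::euclidean_space set \<Rightarrow> ('a \<Rightarrow> real) \<Rightarrow> bool" where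
  "C2_on S \<phi> \<longleftrightarrow>
     (\<exists>(D :: 'a \<Rightarrow> 'a \<Rightarrow>\<^sub>L real) (D2 :: 'a \<Rightarrow> 'a \<Rightarrow>\<^sub>L 'a \<Rightarrow>\<^sub>L real).
        (\<forall>z\<in>S. (\<phi> has_derivative blinfun_apply (D z)) (at z)) \<and>
        (\<forall>z\<in>S. (D has_derivative blinfun_apply (D2 z)) (at z)) \<and>
        continuous_on S D2)"

section \<open>Admissible test functions\<close>

text \<open>Derivatives at the endpoint \<open>0\<close> of \<open>{0..}\<close> are one-sided.\<close>

definition class_F :: "(real^'n \<Rightarrow> real^'n^'n \<Rightarrow> real) \<Rightarrow> (real \<Rightarrow> real) set" where
  "class_F F = {f.
     (\<exists>f' f''.
        (\<forall>r\<ge>0. (f has_real_derivative f' r) (at r within {0..})) \<and>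
        (\<forall>r\<ge>0. (f' has_real_derivative f'' r) (at r within {0..})) \<and>
        continuous_on {0..} f'' \<and>
        f 0 = 0 \<and> f' 0 = 0 \<and> f'' 0 = 0 \<and> (\<forall>r>0. f'' r > 0)) \<and>
     ((\<lambda>x. F (gradient (\<lambda>y. f (norm y)) x) (hessian (\<lambda>y. f (norm y)) x)) \<longlongrightarrow> 0) (at 0)}"

definition class_Sigma :: "(real \<Rightarrow> real) set" where
  "class_Sigma = {\<sigma>. \<sigma> C1_differentiable_on UNIV \<and> (\<forall>r. \<sigma> (- r) = \<sigma> r) \<and>
     \<sigma> 0 = 0 \<and> deriv \<sigma> 0 = 0 \<and> (\<forall>r>0. \<sigma> r > 0)}"

definition space_gradient :: "((real^'n) \<times> real \<Rightarrow> real) \<Rightarrow> (real^'n) \<times> real \<Rightarrow> real^'n" where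
  "space_gradient \<phi> \<xi> = gradient (\<lambda>y. \<phi> (y, snd \<xi>)) (fst \<xi>)"

definition time_deriv :: "((real^'n) \<times> real \<Rightarrow> real) \<Rightarrow> (real^'n) \<times> real \<Rightarrow> real" where
  "time_deriv \<phi> \<xi> = deriv (\<lambda>s. \<phi> (fst \<xi>, s)) (snd \<xi>)"

text \<open>
  The bound need not mention \<open>\<Theta>\<close>: it persists when \<open>\<delta>\<close> shrinks, so for \<open>(x0, t0)\<close> in an open
  set \<open>\<Theta>\<close> one may always take the cylinder inside \<open>\<Theta>\<close>.
\<close>

definition admissible_at ::
    "real \<Rightarrow> real \<Rightarrow> ((real^'n) \<times> real \<Rightarrow> real) \<Rightarrow> (real^'n) \<times> real \<Rightarrow> bool" where
  "admissible_at p q \<phi> = (\<lambda>(x0, t0).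
     space_gradient \<phi> (x0, t0) \<noteq> 0 \<or>
     (\<exists>\<delta>>0. \<exists>f \<in> class_F (pq_F p q :: real^'n \<Rightarrow> real^'n^'n \<Rightarrow> real). \<exists>\<sigma> \<in> class_Sigma.
        \<forall>x \<in> ball x0 \<delta>. \<forall>t \<in> {t0 - \<delta> <..< t0 + \<delta>}.
          \<bar>\<phi> (x, t) - \<phi> (x0, t0) - time_deriv \<phi> (x0, t0) * (t - t0)\<bar>
            \<le> f (norm (x - x0)) + \<sigma> (t - t0)))"

section \<open>Viscosity supersolutions\<close>

definition lower_semicontinuous_on :: "'a::metric_space set \<Rightarrow> ('a \<Rightarrow> ereal) \<Rightarrow> bool" where
  "lower_semicontinuous_on S u \<longleftrightarrow> (\<forall>\<xi>\<in>S. u \<xi> \<le> Liminf (at \<xi> within S) u)"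

definition touches_from_below ::
    "((real^'n) \<times> real) set \<Rightarrow> ((real^'n) \<times> real \<Rightarrow> real) \<Rightarrow> ((real^'n) \<times> real \<Rightarrow> ereal) \<Rightarrow>
     (real^'n) \<times> real \<Rightarrow> bool" where
  "touches_from_below \<Theta> \<phi> u \<xi> \<longleftrightarrow>
     ereal (\<phi> \<xi>) = u \<xi> \<and> (\<forall>\<^sub>F \<eta> in at \<xi> within \<Theta>. ereal (\<phi> \<eta>) < u \<eta>)"

definition viscosity_supersolution ::
    "real \<Rightarrow> real \<Rightarrow> ((real^'n) \<times> real) set \<Rightarrow> ((real^'n) \<times> real \<Rightarrow> ereal) \<Rightarrow> bool" where
  "viscosity_supersolution p q \<Theta> u \<longleftrightarrow>
     (\<forall>\<xi>\<in>\<Theta>. u \<xi> \<noteq> -\<infinity>) \<and>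
     lower_semicontinuous_on \<Theta> u \<and>
     \<Theta> \<subseteq> closure {\<xi>\<in>\<Theta>. u \<xi> \<noteq> \<infinity>} \<and>
     (\<forall>\<phi>. \<forall>\<xi>\<in>\<Theta>. C2_on \<Theta> \<phi> \<and> admissible_at p q \<phi> \<xi> \<and> touches_from_below \<Theta> \<phi> u \<xi> \<longrightarrow>
        (space_gradient \<phi> \<xi> \<noteq> 0 \<longrightarrow>
           time_deriv \<phi> \<xi> - pq_laplacian p q (\<lambda>y. \<phi> (y, snd \<xi>)) (fst \<xi>) \<ge> 0) \<and>
        (space_gradient \<phi> \<xi> = 0 \<longrightarrow> time_deriv \<phi> \<xi> \<ge> 0))"

section \<open>Perron solutions and boundary regularity\<close>

definition upper_class ::
    "real \<Rightarrow> real \<Rightarrow> ((real^'n) \<times> real) set \<Rightarrow> ((real^'n) \<times> real \<Rightarrow> real) \<Rightarrow>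
     ((real^'n) \<times> real \<Rightarrow> ereal) set" where
  "upper_class p q \<Theta> f = {u.
     viscosity_supersolution p q \<Theta> u \<and>
     (\<exists>m::real. \<forall>\<xi>\<in>\<Theta>. ereal m \<le> u \<xi>) \<and>
     (\<forall>\<xi>\<in>frontier \<Theta>. ereal (f \<xi>) \<le> Liminf (at \<xi> within \<Theta>) u)}"

definition upper_Perron ::
    "real \<Rightarrow> real \<Rightarrow> ((real^'n) \<times> real) set \<Rightarrow> ((real^'n) \<times> real \<Rightarrow> real) \<Rightarrow>
     (real^'n) \<times> real \<Rightarrow> ereal" where
  "upper_Perron p q \<Theta> f \<xi> = (INF u \<in> upper_class p q \<Theta> f. u \<xi>)"

definition regular_point ::
    "real \<Rightarrow> real \<Rightarrow> ((real^'n) \<times> real) set \<Rightarrow> (real^'n) \<times> real \<Rightarrow> bool" where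
  "regular_point p q \<Theta> \<xi>0 \<longleftrightarrow> \<xi>0 \<in> frontier \<Theta> \<and>
     (\<forall>f. continuous_on (frontier \<Theta>) f \<longrightarrow>
        (upper_Perron p q \<Theta> f \<longlongrightarrow> ereal (f \<xi>0)) (at \<xi>0 within \<Theta>))"

end

theory Submission
  imports Defs
begin

text \<open>
  Both halves of regularity come from one exponential barrier
  \<open>h z = K - K * exp (\<alpha> * (\<bar>\<xi>0 - a\<bar>\<^sup>2 - \<bar>z - a\<bar>\<^sup>2))\<close> with \<open>a\<close> in the exterior ball. Its spatial
  gradient does not vanish near \<open>\<xi>0\<close>, because \<open>x1 \<noteq> x0\<close>. The equation is not homogeneous, so the barrier cannot be
  multiplied by constants afterwards; instead \<open>K\<close> is fixed by the bound on the boundary data and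
  \<open>\<alpha>\<close> is taken large. Truncating \<open>f \<xi>0 + \<epsilon> + h\<close> at a constant gives a member of the upper class.
  Conversely, every member of the upper class is bounded below by the minimum of the boundary data
  and lies above the strict subsolution \<open>f \<xi>0 - \<epsilon> - h\<close>: at an interior minimum of the difference a
  translate of the subsolution would be a forbidden test function. All these test functions have
  nonzero gradient, so the class of admissible \<open>f\<close> at critical points plays no role.
\<close>

section \<open>Twice differentiable functions\<close>

text \<open>The witnesses hidden in \<open>C2_on\<close> become parameters, because contact
  arguments compare the derivatives of two functions and the operator is evaluated directly on
  \<open>D\<close> and \<open>D2\<close>.\<close>

definition C2_derivs ::
    "'a::euclidean_space set \<Rightarrow> ('a \<Rightarrow> real) \<Rightarrow> ('a \<Rightarrow> 'a \<Rightarrow>\<^sub>L real) \<Rightarrow>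
     ('a \<Rightarrow> 'a \<Rightarrow>\<^sub>L 'a \<Rightarrow>\<^sub>L real) \<Rightarrow> bool" where
  "C2_derivs S \<phi> D D2 \<longleftrightarrow>
     (\<forall>z\<in>S. (\<phi> has_derivative blinfun_apply (D z)) (at z)) \<and>
     (\<forall>z\<in>S. (D has_derivative blinfun_apply (D2 z)) (at z)) \<and>
     continuous_on S D2"

lemma C2_on_iff_C2_derivs: "C2_on S \<phi> \<longleftrightarrow> (\<exists>D D2. C2_derivs S \<phi> D D2)"
  by (simp add: C2_on_def C2_derivs_def)

lemma C2_derivs_subset: "C2_derivs S \<phi> D D2 \<Longrightarrow> T \<subseteq> S \<Longrightarrow> C2_derivs T \<phi> D D2"
  by (auto simp: C2_derivs_def intro: continuous_on_subset)

lemma C2_derivs_diff: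
  assumes "C2_derivs S \<phi> D D2" "C2_derivs S \<psi> E E2"
  shows "C2_derivs S (\<lambda>z. \<phi> z - \<psi> z) (\<lambda>z. D z - E z) (\<lambda>z. D2 z - E2 z)"
  using assms unfolding C2_derivs_def
  by (auto simp: blinfun.diff_left
      intro!: continuous_on_diff has_derivative_diff[THEN has_derivative_eq_rhs])

lemma C2_derivs_add_const:
  "C2_derivs S \<phi> D D2 \<Longrightarrow> C2_derivs S (\<lambda>z. \<phi> z + c) D D2"
  by (auto simp: C2_derivs_def intro: has_derivative_add_const)

text \<open>One form covers both the full and the purely spatial squared distance to
  \<open>a\<close>. The quartic perturbation of test functions and all barriers are functions of one
  real variable composed with it.\<close>

definition quad :: "('a::euclidean_space \<Rightarrow>\<^sub>L 'a) \<Rightarrow> 'a \<Rightarrow> 'a \<Rightarrow> real" where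
  "quad T a z = T (z - a) \<bullet> (z - a)"

text \<open>Since \<open>T\<close> is self-adjoint, the gradient of \<open>quad T a\<close> at
  \<open>z\<close> is \<open>2 *\<^sub>R T (z - a)\<close>. The chain rule then gives a second
  derivative consisting of a multiple of \<open>T\<close> and a rank one term built from
  \<open>T (z - a)\<close>.\<close>

lemma C2_derivs_quad:
  fixes T :: "'a::euclidean_space \<Rightarrow>\<^sub>L 'a" and g g' g'' :: "real \<Rightarrow> real"
  assumes sa: "\<And>x y. T x \<bullet> y = x \<bullet> T y"
    and g: "\<And>s. (g has_real_derivative g' s) (at s)"
    and g': "\<And>s. (g' has_real_derivative g'' s) (at s)"
    and cont: "continuous_on UNIV g''"
  shows "C2_derivs UNIV (\<lambda>z. g (quad T a z))
    (\<lambda>z. (2 * g' (quad T a z)) *\<^sub>R blinfun_inner_right (T (z - a)))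
    (\<lambda>z. (2 * g' (quad T a z)) *\<^sub>R (Blinfun blinfun_inner_right o\<^sub>L T) +
         (4 * g'' (quad T a z)) *\<^sub>R
           (blinfun_scaleR_left (blinfun_inner_right (T (z - a))) o\<^sub>L
            blinfun_inner_right (T (z - a))))"
proof -
  have q: "(quad T a has_derivative (\<lambda>h. 2 * (T (z - a) \<bullet> h))) (at z)" for z
    unfolding quad_def
    by (rule derivative_eq_intros refl | simp add: sa inner_commute)+
  have qc: "continuous_on UNIV (quad T a)"
    unfolding quad_def by (intro continuous_intros)
  have gq: "((\<lambda>z. g (quad T a z)) has_derivative
      (\<lambda>h. g' (quad T a z) * (2 * (T (z - a) \<bullet> h)))) (at z)" for z
    using has_derivative_compose[OF q, of g "\<lambda>h. g' (quad T a z) * h"] g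
    by (simp add: has_field_derivative_def)
  have g'q: "((\<lambda>z. g' (quad T a z)) has_derivative
      (\<lambda>h. g'' (quad T a z) * (2 * (T (z - a) \<bullet> h)))) (at z)" for z
    using has_derivative_compose[OF q, of g' "\<lambda>h. g'' (quad T a z) * h"] g'
    by (simp add: has_field_derivative_def)
  have t: "((\<lambda>z. blinfun_inner_right (T (z - a))) has_derivative
      (\<lambda>h. blinfun_inner_right (T h))) (at z)" for z
    by (rule derivative_eq_intros refl bounded_linear.has_derivative[OF bounded_linear_blinfun_inner_right] | simp)+
  have D: "((\<lambda>z. (2 * g' (quad T a z)) *\<^sub>R blinfun_inner_right (T (z - a))) has_derivative
     (\<lambda>h. (2 * g' (quad T a z)) *\<^sub>R blinfun_inner_right (T h) +
        (2 * (g'' (quad T a z) * (2 * (T (z - a) \<bullet> h)))) *\<^sub>R blinfun_inner_right (T (z - a)))) (at z)" for z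
    by (intro has_derivative_scaleR t has_derivative_mult_right g'q)
  have contg': "continuous_on UNIV g'"
    using g' by (meson DERIV_isCont continuous_at_imp_continuous_on)
  show ?thesis
    unfolding C2_derivs_def
  proof (intro conjI ballI)
    fix z
    show "((\<lambda>z. g (quad T a z)) has_derivative
       blinfun_apply ((2 * g' (quad T a z)) *\<^sub>R blinfun_inner_right (T (z - a)))) (at z)"
      by (rule has_derivative_eq_rhs[OF gq]) (auto simp: blinfun.scaleR_left)
    show "((\<lambda>z. (2 * g' (quad T a z)) *\<^sub>R blinfun_inner_right (T (z - a))) has_derivative
       blinfun_apply ((2 * g' (quad T a z)) *\<^sub>R (Blinfun blinfun_inner_right o\<^sub>L T) +
         (4 * g'' (quad T a z)) *\<^sub>R
           (blinfun_scaleR_left (blinfun_inner_right (T (z - a))) o\<^sub>L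
            blinfun_inner_right (T (z - a))))) (at z)"
      by (rule has_derivative_eq_rhs[OF D])
        (auto simp: blinfun.add_left blinfun.scaleR_left
          bounded_linear_Blinfun_apply[OF bounded_linear_blinfun_inner_right])
  next
    have c1: "continuous_on UNIV (\<lambda>z. g' (quad T a z))" "continuous_on UNIV (\<lambda>z. g'' (quad T a z))"
      by (rule continuous_on_compose2[OF contg' qc] continuous_on_compose2[OF cont qc], simp)+
    show "continuous_on UNIV (\<lambda>z. (2 * g' (quad T a z)) *\<^sub>R (Blinfun blinfun_inner_right o\<^sub>L T) +
         (4 * g'' (quad T a z)) *\<^sub>R
           (blinfun_scaleR_left (blinfun_inner_right (T (z - a))) o\<^sub>L
            blinfun_inner_right (T (z - a))))"
      by (intro continuous_intros c1
          bounded_linear.continuous_on[OF bounded_linear_blinfun_inner_right]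
          bounded_linear.continuous_on[OF bounded_linear_blinfun_scaleR_left])
  qed
qed

text \<open>Restriction to the line through \<open>z\<close> in direction \<open>h\<close>: if
  \<open>D2 z h h\<close> were positive, the slope along the line, which is zero at
  \<open>z\<close>, would be positive just after it, and the mean value theorem would produce a
  larger value of \<psi>.\<close>

lemma second_derivative_le_0_at_local_max:
  assumes C2: "C2_derivs S \<psi> D D2" and S: "open S" "z \<in> S"
    and max: "\<forall>\<^sub>F y in at z. \<psi> y \<le> \<psi> z"
  shows "D z = 0" "D2 z h h \<le> 0"
proof -
  have ev: "\<forall>\<^sub>F y in nhds z. \<psi> y \<le> \<psi> z"
    using max by (simp add: eventually_nhds_conv_at)
  obtain e where e: "e > 0" "ball z e \<subseteq> S" "\<And>y. y \<in> ball z e \<Longrightarrow> \<psi> y \<le> \<psi> z"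
  proof -
    obtain d where d: "d > 0" "\<And>y. dist y z < d \<Longrightarrow> \<psi> y \<le> \<psi> z"
      using ev by (auto simp: eventually_nhds_metric)
    obtain d' where d': "d' > 0" "ball z d' \<subseteq> S"
      using S by (auto simp: open_contains_ball)
    show ?thesis
      by (rule that[of "min d d'"]) (use d d' in \<open>auto simp: dist_commute\<close>)
  qed
  have D: "(\<psi> has_derivative D y) (at y)" "(D has_derivative D2 y) (at y)" if "y \<in> S" for y
    using C2 that by (auto simp: C2_derivs_def)
  have "blinfun_apply (D z) = (\<lambda>h. 0)"
    by (rule differential_zero_maxmin[of z "ball z e" \<psi>]) (use e D S in auto)
  then show D0: "D z = 0"
    by (intro blinfun_eqI) simp
  show "D2 z h h \<le> 0"
  proof (rule ccontr)
    assume "\<not> D2 z h h \<le> 0"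
    then have pos: "D2 z h h > 0" by simp
    then have h: "norm h > 0" by (cases "h = 0") (auto simp: blinfun.zero_right)
    define r where "r = e / norm h"
    have r: "r > 0" using e h by (simp add: r_def)
    have inb: "z + s *\<^sub>R h \<in> ball z e" if "\<bar>s\<bar> < r" for s
      using that h by (simp add: dist_norm r_def field_simps)
    have line: "((\<lambda>s. z + s *\<^sub>R h) has_derivative (\<lambda>s. s *\<^sub>R h)) (at s)" for s
      by (auto intro!: derivative_eq_intros)
    have d1: "((\<lambda>s. \<psi> (z + s *\<^sub>R h)) has_real_derivative D (z + s *\<^sub>R h) h) (at s)"
      if "\<bar>s\<bar> < r" for s
    proof -
      have "z + s *\<^sub>R h \<in> S" using inb[OF that] e by auto
      from has_derivative_compose[OF line D(1)[OF this]]
      show ?thesis by (simp add: has_field_derivative_def blinfun.scaleR_right mult_commute_abs)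
    qed
    have d2: "((\<lambda>s. D (z + s *\<^sub>R h) h) has_real_derivative D2 z h h) (at 0)"
    proof -
      have "(D has_derivative D2 z) (at (z + 0 *\<^sub>R h))" using D(2) S by simp
      from has_derivative_compose[OF line this]
      have "((\<lambda>s. D (z + s *\<^sub>R h)) has_derivative (\<lambda>s. D2 z (s *\<^sub>R h))) (at 0)" by simp
      from blinfun.FDERIV[OF this has_derivative_const[of h]]
      show ?thesis
        by (simp add: has_field_derivative_def blinfun.scaleR_right blinfun.scaleR_left
            blinfun.zero_right mult_commute_abs)
    qed
    obtain d where d: "d > 0" "\<And>s. 0 < s \<Longrightarrow> s < d \<Longrightarrow> D (z + s *\<^sub>R h) h > 0"
      using DERIV_pos_inc_right[OF d2 pos] D0 by auto
    define s where "s = min d r / 2"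
    have s: "0 < s" "s < d" "s < r" using d r by (auto simp: s_def)
    have "\<exists>\<xi>. 0 < \<xi> \<and> \<xi> < s \<and>
        \<psi> (z + s *\<^sub>R h) - \<psi> (z + 0 *\<^sub>R h) = (s - 0) * D (z + \<xi> *\<^sub>R h) h"
      by (rule MVT2) (use s d1 in auto)
    then obtain \<xi> where "0 < \<xi>" "\<xi> < s"
      "\<psi> (z + s *\<^sub>R h) - \<psi> z = s * D (z + \<xi> *\<^sub>R h) h" by auto
    then have "\<psi> (z + s *\<^sub>R h) > \<psi> z"
      using d(2)[of \<xi>] s by (smt (verit) mult_pos_pos)
    moreover have "\<psi> (z + s *\<^sub>R h) \<le> \<psi> z"
      by (rule e(3), rule inb) (use s in auto)
    ultimately show False by simp
  qed
qed

section \<open>The operator in terms of space-time derivatives\<close>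

definition space_unit :: "'n \<Rightarrow> (real^'n) \<times> real" where
  "space_unit i = (axis i 1, 0)"

definition space_part :: "(((real^'n) \<times> real) \<Rightarrow>\<^sub>L real) \<Rightarrow> real^'n" where
  "space_part d = (\<chi> i. d (space_unit i))"

text \<open>This is \<open>pq_F\<close> expressed through bilinear forms on space-time: the trace of
  \<open>tensor \<eta> \<eta> ** X\<close> is the quadratic form of \<open>X\<close> at \<eta>, so
  no Hessian matrix has to be formed.\<close>

definition pq_op :: "real \<Rightarrow> real \<Rightarrow> (((real^'n) \<times> real) \<Rightarrow>\<^sub>L real) \<Rightarrow>
    (((real^'n) \<times> real) \<Rightarrow>\<^sub>L ((real^'n) \<times> real) \<Rightarrow>\<^sub>L real) \<Rightarrow> real" where
  "pq_op p q d B = norm (space_part d) powr (q - 2) *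
     ((\<Sum>i\<in>UNIV. B (space_unit i) (space_unit i)) +
      (p - 2) * B (space_part d, 0) (space_part d, 0) / (norm (space_part d))\<^sup>2)"

lemma bounded_linear_space_part:
  "bounded_linear (space_part :: (((real^'n) \<times> real) \<Rightarrow>\<^sub>L real) \<Rightarrow> real^'n)"
proof (rule bounded_linear_intro)
  fix d :: "((real^'n) \<times> real) \<Rightarrow>\<^sub>L real"
  have "norm (space_part d) \<le> (\<Sum>i\<in>UNIV. \<bar>space_part d $ i\<bar>)"
    by (rule norm_le_l1_cart)
  also have "\<dots> \<le> (\<Sum>i\<in>(UNIV :: 'n set). norm d)"
  proof (rule sum_mono)
    show "\<bar>space_part d $ i\<bar> \<le> norm d" for i
      using norm_blinfun[of d "space_unit i"] by (simp add: space_part_def space_unit_def norm_Pair)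
  qed
  finally show "norm (space_part d) \<le> norm d * CARD('n)" by (simp add: mult.commute)
qed (simp_all add: space_part_def vec_eq_iff blinfun.add_left blinfun.scaleR_left)

lemma space_vec_eq_sum: "((v::real^'n), 0::real) = (\<Sum>i\<in>UNIV. v $ i *\<^sub>R space_unit i)"
proof -
  have "(\<Sum>i\<in>UNIV. v $ i *\<^sub>R space_unit i) = (\<Sum>i\<in>UNIV. v $ i *\<^sub>R axis i 1, 0)"
    by (simp add: space_unit_def prod_eq_iff fst_sum snd_sum)
  moreover have "(\<Sum>i\<in>UNIV. v $ i *\<^sub>R axis i 1) = v"
    by (simp add: vec_eq_iff axis_def if_distrib cong: if_cong)
  ultimately show ?thesis by simp
qed

lemma blinfun_space_vec: "blinfun_apply d (v, 0) = v \<bullet> space_part d"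
  unfolding space_vec_eq_sum[of v]
  by (simp add: blinfun.sum_right blinfun.scaleR_right space_part_def inner_vec_def)

lemma blinfun_space_vec2:
  "blinfun_apply (blinfun_apply B (v, 0)) (v, 0) =
    (\<Sum>i\<in>UNIV. \<Sum>j\<in>UNIV. v $ i * v $ j * B (space_unit i) (space_unit j))"
  unfolding space_vec_eq_sum[of v]
  by (simp add: blinfun.sum_right blinfun.sum_left blinfun.scaleR_right blinfun.scaleR_left
      sum_distrib_left mult.assoc) (subst sum.swap, simp add: mult_ac)

lemma gradient_eqI: "GDERIV g x :> d \<Longrightarrow> gradient g x = d"
proof -
  assume d: "GDERIV g x :> d"
  have "d' = d" if "GDERIV g x :> d'" for d'
  proof -
    have "(\<lambda>h. h \<bullet> d') = (\<lambda>h. h \<bullet> d)"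
      using that d unfolding gderiv_def by (rule has_derivative_unique)
    then show ?thesis by (metis inner_commute vector_eq_rdot)
  qed
  then show ?thesis using d unfolding gradient_def by blast
qed

text \<open>The operators in the definition of supersolutions act on slices in space or time. Each
  slice is \<phi> composed with an affine embedding, so the chain rule expresses them through
  \<open>D\<close> and \<open>D2\<close>.\<close>

lemma
  fixes \<phi> :: "(real^'n) \<times> real \<Rightarrow> real"
  assumes C2: "C2_derivs S \<phi> D D2" and S: "open S" "\<xi> \<in> S"
  shows space_gradient_C2: "space_gradient \<phi> \<xi> = space_part (D \<xi>)"
    and time_deriv_C2: "time_deriv \<phi> \<xi> = D \<xi> (0, 1)"
    and pq_laplacian_C2: "space_part (D \<xi>) \<noteq> 0 \<Longrightarrow>
      pq_laplacian p q (\<lambda>y. \<phi> (y, snd \<xi>)) (fst \<xi>) = pq_op p q (D \<xi>) (D2 \<xi>)"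
proof -
  obtain x t where \<xi>: "\<xi> = (x, t)" by force
  have D: "(\<phi> has_derivative D y) (at y)" "(D has_derivative D2 y) (at y)" if "y \<in> S" for y
    using C2 that by (auto simp: C2_derivs_def)
  have slice: "((\<lambda>y. (y, t)) has_derivative (\<lambda>h. (h, 0))) (at y)" for y :: "real^'n"
    by (auto intro!: derivative_eq_intros)
  have gr: "gradient (\<lambda>y. \<phi> (y, t)) y = space_part (D (y, t))" if "(y, t) \<in> S" for y
    using has_derivative_compose[OF slice D(1)[OF that]]
    by (intro gradient_eqI) (simp add: gderiv_def blinfun_space_vec)
  show sg: "space_gradient \<phi> \<xi> = space_part (D \<xi>)"
    using gr S by (simp add: space_gradient_def \<xi>)
  have line: "((\<lambda>s. (x, s)) has_derivative (\<lambda>s. (0, s))) (at t)"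
    by (auto intro!: derivative_eq_intros)
  have "((\<lambda>s. \<phi> (x, s)) has_derivative (\<lambda>s. D \<xi> (0, s))) (at t)"
    using has_derivative_compose[OF line D(1)[OF S(2)[unfolded \<xi>]]] by (simp add: \<xi>)
  moreover have "(\<lambda>s. D \<xi> (0, s)) = (*) (D \<xi> (0, 1))"
  proof
    show "D \<xi> (0, s) = D \<xi> (0, 1) * s" for s
      using blinfun.scaleR_right[of "D \<xi>" s "(0, 1)"] by simp
  qed
  ultimately have "((\<lambda>s. \<phi> (x, s)) has_real_derivative D \<xi> (0, 1)) (at t)"
    by (simp add: has_field_derivative_def)
  then show "time_deriv \<phi> \<xi> = D \<xi> (0, 1)"
    by (simp add: time_deriv_def \<xi> DERIV_imp_deriv)
  \<comment> \<open>The Hessian differentiates \<open>gradient\<close>, so the formula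
    \<open>gr\<close> is needed in a whole neighbourhood of \<open>x\<close> and not only at
    \<open>x\<close>.\<close>
  have "open ((\<lambda>y. (y, t)) -` S)"
    by (intro open_vimage S continuous_intros)
  then have ev: "\<forall>\<^sub>F y in nhds x. (y, t) \<in> S"
    using S by (auto simp: eventually_nhds \<xi>)
  have "((\<lambda>y. space_part (D (y, t))) has_derivative (\<lambda>h. space_part (D2 \<xi> (h, 0)))) (at x)"
    using bounded_linear.has_derivative[OF bounded_linear_space_part
        has_derivative_compose[OF slice D(2)[OF S(2)[unfolded \<xi>]]]] by (simp add: \<xi>)
  then have hg: "(gradient (\<lambda>y. \<phi> (y, t)) has_derivative (\<lambda>h. space_part (D2 \<xi> (h, 0)))) (at x)"
    by (rule has_derivative_transform_eventually)
      (use ev gr S in \<open>auto simp: \<xi> eventually_at_filter elim: eventually_mono\<close>)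
  then have hess: "hessian (\<lambda>y. \<phi> (y, t)) x =
      (\<chi> i j. D2 \<xi> (space_unit j) (space_unit i))"
    unfolding hessian_def jacobian_def frechet_derivative_at[OF hg, symmetric]
    by (simp add: matrix_def space_part_def space_unit_def)
  assume nz: "space_part (D \<xi>) \<noteq> 0"
  have "pq_laplacian p q (\<lambda>y. \<phi> (y, t)) x =
      pq_F p q (gradient (\<lambda>y. \<phi> (y, t)) x) (hessian (\<lambda>y. \<phi> (y, t)) x)"
    by (rule pq_laplacian_eq_pq_F)
      (use hg nz gr S in \<open>auto simp: \<xi> differentiable_def\<close>)
  also have "\<dots> = pq_op p q (D \<xi>) (D2 \<xi>)"
    using gr S unfolding hess pq_F_def pq_op_def \<xi>
    by (simp add: trace_def matrix_matrix_mult_def tensor_def sum.distrib blinfun_space_vec2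
        sum_distrib_left sum_distrib_right sum_divide_distrib mult_ac)
  finally show "pq_laplacian p q (\<lambda>y. \<phi> (y, snd \<xi>)) (fst \<xi>) = pq_op p q (D \<xi>) (D2 \<xi>)"
    by (simp add: \<xi>)
qed

text \<open>Degenerate ellipticity, used at contact points where two second derivatives are ordered.
  With \<open>X = C - B\<close> and the unit vector \<eta> along the spatial gradient, the
  difference of the brackets is
  \<open>(trace X - X \<eta> \<eta>) + (p - 1) * X \<eta> \<eta>\<close>, a sum of two nonnegative
  terms.\<close>

lemma pq_op_mono:
  assumes p: "p > 1" and nz: "space_part d \<noteq> 0"
    and B: "\<And>h. blinfun_apply (blinfun_apply B h) h \<le> blinfun_apply (blinfun_apply C h) h"
  shows "pq_op p q d B \<le> pq_op p q d C"
proof -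
  define X where "X = C - B"
  have X: "X h h \<ge> 0" for h using B[of h] by (simp add: X_def blinfun.diff_left)
  define \<eta> where "\<eta> = sgn (space_part d)"
  have n1: "\<eta> \<bullet> \<eta> = 1" using nz by (simp add: \<eta>_def norm_sgn dot_square_norm)
  have eta2: "X (space_part d, 0) (space_part d, 0) / (norm (space_part d))\<^sup>2 = X (\<eta>, 0) (\<eta>, 0)"
  proof -
    have "(\<eta>, 0) = (1 / norm (space_part d)) *\<^sub>R (space_part d, 0::real)"
      by (simp add: \<eta>_def sgn_div_norm inverse_eq_divide)
    then show ?thesis
      by (simp add: blinfun.scaleR_right blinfun.scaleR_left power2_eq_square
          del: scaleR_Pair)
  qed
  \<comment> \<open>The projections of the coordinate vectors to the complement of \<open>\<eta>\<close> give
    \<open>trace X - X \<eta> \<eta> \<ge> 0\<close>, so \<open>p > 1\<close> suffices even when \<open>p - 2\<close> is negative.\<close>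
  let ?e = "space_unit :: 'a \<Rightarrow> _"
  let ?E = "(\<eta>, 0::real)"
  have "0 \<le> (\<Sum>i\<in>UNIV. X (?e i - \<eta> $ i *\<^sub>R ?E) (?e i - \<eta> $ i *\<^sub>R ?E))"
    by (intro sum_nonneg X)
  also have "\<dots> = (\<Sum>i\<in>UNIV. X (?e i) (?e i)) - (\<Sum>i\<in>UNIV. \<eta> $ i * X (?e i) ?E)
      - (\<Sum>i\<in>UNIV. \<eta> $ i * X ?E (?e i)) + (\<Sum>i\<in>UNIV. \<eta> $ i * \<eta> $ i) * X ?E ?E"
    by (simp add: blinfun.diff_left blinfun.diff_right blinfun.scaleR_left blinfun.scaleR_right
        sum.distrib sum_subtractf sum_distrib_right sum_distrib_left algebra_simps del: scaleR_Pair)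
  also have "(\<Sum>i\<in>UNIV. \<eta> $ i * X (?e i) ?E) = X ?E ?E"
  proof -
    have "X ?E ?E = X (\<Sum>i\<in>UNIV. \<eta> $ i *\<^sub>R ?e i) ?E" by (simp flip: space_vec_eq_sum)
    then show ?thesis by (simp add: blinfun.sum_left blinfun.sum_right blinfun.scaleR_left blinfun.scaleR_right)
  qed
  also have "(\<Sum>i\<in>UNIV. \<eta> $ i * X ?E (?e i)) = X ?E ?E"
  proof -
    have "X ?E ?E = X ?E (\<Sum>i\<in>UNIV. \<eta> $ i *\<^sub>R ?e i)" by (simp flip: space_vec_eq_sum)
    then show ?thesis by (simp add: blinfun.sum_left blinfun.sum_right blinfun.scaleR_left blinfun.scaleR_right)
  qed
  also have "(\<Sum>i\<in>UNIV. \<eta> $ i * \<eta> $ i) = 1" using n1 by (simp add: inner_vec_def)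
  finally have tr: "X ?E ?E \<le> (\<Sum>i\<in>UNIV. X (?e i) (?e i))" by simp
  have "0 \<le> (p - 1) * X ?E ?E" using p X by simp
  then have "0 \<le> (\<Sum>i\<in>UNIV. X (?e i) (?e i)) + (p - 2) * X ?E ?E"
    using tr by (simp add: algebra_simps)
  also have "\<dots> = ((\<Sum>i\<in>UNIV. C (?e i) (?e i)) + (p - 2) * C (space_part d, 0) (space_part d, 0) / (norm (space_part d))\<^sup>2)
    - ((\<Sum>i\<in>UNIV. B (?e i) (?e i)) + (p - 2) * B (space_part d, 0) (space_part d, 0) / (norm (space_part d))\<^sup>2)"
    unfolding eta2[symmetric]
    by (simp add: X_def blinfun.diff_left sum_subtractf algebra_simps diff_divide_distrib)
  finally show ?thesis unfolding pq_op_def by (intro mult_left_mono) auto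
qed

section \<open>Comparison and truncation\<close>

lemma quad_id: "quad id_blinfun a z = (norm (z - a))\<^sup>2"
  by (simp add: quad_def dot_square_norm)

text \<open>Minimising a difference yields contact that need not be strict, whereas the definition
  tests strict contact only; this closes the gap. The nonzero spatial gradient gives admissibility
  through the first alternative of \<open>admissible_at\<close>.\<close>

lemma supersolution_touching_test:
  fixes \<Theta> :: "((real^'n) \<times> real) set"
  assumes u: "viscosity_supersolution p q \<Theta> u" and "open \<Theta>"
    and C2: "C2_derivs \<Theta> \<phi> D D2" and \<xi>: "\<xi> \<in> \<Theta>" and nz: "space_part (D \<xi>) \<noteq> 0"
    and eq: "u \<xi> = ereal (\<phi> \<xi>)" and le: "\<And>\<eta>. \<eta> \<in> \<Theta> \<Longrightarrow> ereal (\<phi> \<eta>) \<le> u \<eta>"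
  shows "pq_op p q (D \<xi>) (D2 \<xi>) \<le> D \<xi> (0, 1)"
proof -
  \<comment> \<open>Subtracting a quartic makes the contact strict without changing \<open>D\<close> and \<open>D2\<close> at \<open>\<xi>\<close>.\<close>
  define \<psi> where "\<psi> z = \<phi> z - (quad id_blinfun \<xi> z)\<^sup>2" for z
  let ?Q = "\<lambda>z. quad id_blinfun \<xi> z" and ?w = "\<lambda>z. blinfun_inner_right (id_blinfun (z - \<xi>))"
  let ?d = "\<lambda>z. (2 * (2 * ?Q z)) *\<^sub>R ?w z"
  let ?d2 = "\<lambda>z. (2 * (2 * ?Q z)) *\<^sub>R (Blinfun blinfun_inner_right o\<^sub>L id_blinfun) +
      (4 * 2) *\<^sub>R (blinfun_scaleR_left (?w z) o\<^sub>L ?w z)"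
  define E where "E z = D z - ?d z" for z
  define E2 where "E2 z = D2 z - ?d2 z" for z
  have "C2_derivs UNIV (\<lambda>z. (?Q z)\<^sup>2) ?d ?d2"
    by (rule C2_derivs_quad[where g = "\<lambda>s. s\<^sup>2"]) (auto intro!: derivative_eq_intros)
  from C2_derivs_diff[OF C2 C2_derivs_subset[OF this subset_UNIV]]
  have E: "C2_derivs \<Theta> \<psi> E E2" unfolding \<psi>_def E_def E2_def .
  have Q0: "?Q \<xi> = 0" by (simp add: quad_id)
  have "E \<xi> = D \<xi>" unfolding E_def Q0 by simp
  \<comment> \<open>The coefficient of the rank one term does not vanish at \<xi>; the term
    disappears because its vector \<open>z - \<xi>\<close> does.\<close>
  have "blinfun_scaleR_left (?w \<xi>) o\<^sub>L ?w \<xi> = 0" by (intro blinfun_eqI) simp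
  then have "E2 \<xi> = D2 \<xi>" unfolding E2_def Q0 by simp
  have "space_gradient \<psi> \<xi> \<noteq> 0"
    using space_gradient_C2[OF E \<open>open \<Theta>\<close> \<xi>] nz \<open>E \<xi> = D \<xi>\<close> by simp
  moreover have "admissible_at p q \<psi> \<xi>"
    using calculation by (cases \<xi>) (simp add: admissible_at_def)
  moreover have "touches_from_below \<Theta> \<psi> u \<xi>"
  proof -
    have "\<forall>\<^sub>F \<eta> in at \<xi> within \<Theta>. ereal (\<psi> \<eta>) < u \<eta>"
    proof (unfold eventually_at_topological, intro exI[of _ UNIV] conjI ballI impI)
      fix \<eta> assume "\<eta> \<noteq> \<xi>" "\<eta> \<in> \<Theta>"
      then have "ereal (\<psi> \<eta>) < ereal (\<phi> \<eta>)" by (simp add: \<psi>_def quad_id)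
      then show "ereal (\<psi> \<eta>) < u \<eta>" using le[OF \<open>\<eta> \<in> \<Theta>\<close>] by (rule less_le_trans)
    qed auto
    then show ?thesis by (simp add: touches_from_below_def eq \<psi>_def quad_id)
  qed
  ultimately have "time_deriv \<psi> \<xi> - pq_laplacian p q (\<lambda>y. \<psi> (y, snd \<xi>)) (fst \<xi>) \<ge> 0"
    using u \<xi> E unfolding viscosity_supersolution_def C2_on_iff_C2_derivs by blast
  then show ?thesis
    using time_deriv_C2[OF E \<open>open \<Theta>\<close> \<xi>] pq_laplacian_C2[OF E \<open>open \<Theta>\<close> \<xi>] nz
      \<open>E \<xi> = D \<xi>\<close> \<open>E2 \<xi> = D2 \<xi>\<close> by simp
qed

text \<open>A minimising sequence for \<open>u - \<phi>\<close> has a limit point in the compact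
  closure. The infimum \<open>m\<close> is negative, while on the frontier the lower limit of
  \<open>u - \<phi>\<close> is at least zero, so the limit point is interior; there lower
  semicontinuity shows that \<open>m\<close> is attained.\<close>

lemma lower_semicontinuous_attains_Inf_diff:
  fixes \<Theta> :: "'a::heine_borel set" and u :: "'a \<Rightarrow> ereal" and \<phi> :: "'a \<Rightarrow> real"
  assumes "bounded \<Theta>" and lsc: "lower_semicontinuous_on \<Theta> u"
    and cont: "continuous_on UNIV \<phi>"
    and bdd: "\<And>z. z \<in> \<Theta> \<Longrightarrow> ereal m0 \<le> u z"
    and bdry: "\<And>\<xi>. \<xi> \<in> frontier \<Theta> \<Longrightarrow> ereal (\<phi> \<xi>) \<le> Liminf (at \<xi> within \<Theta>) u"
    and "open \<Theta>" and z: "z \<in> \<Theta>" "u z < ereal (\<phi> z)"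
  obtains \<xi> m where "\<xi> \<in> \<Theta>" "m < 0" "u \<xi> = ereal (\<phi> \<xi> + m)"
    "\<And>\<eta>. \<eta> \<in> \<Theta> \<Longrightarrow> ereal (\<phi> \<eta> + m) \<le> u \<eta>"
proof -
  \<comment> \<open>Since \<open>u\<close> may be infinite, the infimum is taken over the real
    levels \<open>s\<close> that \<open>u - \<phi>\<close> undercuts somewhere.\<close>
  define S where "S = {s::real. \<exists>z\<in>\<Theta>. u z < ereal (\<phi> z + s)}"
  have "compact (closure \<Theta>)" using \<open>bounded \<Theta>\<close> by simp
  then have "bounded (\<phi> ` closure \<Theta>)"
    by (intro compact_imp_bounded compact_continuous_image) (use cont continuous_on_subset in auto)
  then obtain C where C: "\<And>z. z \<in> closure \<Theta> \<Longrightarrow> \<bar>\<phi> z\<bar> \<le> C"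
    by (auto simp: bounded_iff)
  have "m0 - C \<le> s" if sS: "s \<in> S" for s
  proof -
    obtain y where y: "y \<in> \<Theta>" "u y < ereal (\<phi> y + s)" using sS by (auto simp: S_def)
    then have "ereal m0 < ereal (\<phi> y + s)" using bdd le_less_trans by blast
    then show ?thesis using C[of y] y closure_subset by force
  qed
  then have bS: "bdd_below S" by (rule bdd_belowI)
  obtain s0 where s0: "u z < ereal s0" "s0 < \<phi> z"
    using z(2) by (metis ereal_dense2 ereal_less_eq(3) less_ereal.simps(1))
  have sS: "s0 - \<phi> z \<in> S" using s0 z by (auto simp: S_def intro!: bexI[of _ z])
  define m where "m = Inf S"
  have "m \<le> s0 - \<phi> z" unfolding m_def using sS bS by (rule cInf_lower)
  then have m: "m < 0" using s0 by simp
  have low: "ereal (\<phi> \<eta> + m) \<le> u \<eta>" if "\<eta> \<in> \<Theta>" for \<eta>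
  proof (rule ccontr)
    assume "\<not> ereal (\<phi> \<eta> + m) \<le> u \<eta>"
    then have "u \<eta> < ereal (\<phi> \<eta> + m)" by simp
    then obtain r where r: "u \<eta> < ereal r" "r < \<phi> \<eta> + m"
      by (metis ereal_dense2 less_ereal.simps(1))
    then have "r - \<phi> \<eta> \<in> S" using that by (auto simp: S_def intro!: bexI[of _ \<eta>])
    then have "m \<le> r - \<phi> \<eta>" unfolding m_def using bS by (rule cInf_lower)
    then show False using r by simp
  qed
  have "\<exists>y\<in>\<Theta>. u y < ereal (\<phi> y + m + inverse (Suc n))" for n
  proof -
    have "m < m + inverse (Suc n)" by simp
    then obtain s where "s \<in> S" "s < m + inverse (Suc n)"
      using cInf_lessD[of S] sS unfolding m_def by blast
    then obtain y where "y \<in> \<Theta>" "u y < ereal (\<phi> y + s)" by (auto simp: S_def)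
    moreover have "ereal (\<phi> y + s) \<le> ereal (\<phi> y + m + inverse (Suc n))"
      using \<open>s < m + inverse (Suc n)\<close> by simp
    ultimately show ?thesis using less_le_trans by blast
  qed
  then obtain Y where Y: "\<And>n. Y n \<in> \<Theta>" "\<And>n. u (Y n) < ereal (\<phi> (Y n) + m + inverse (Suc n))"
    by metis
  have "\<forall>n. Y n \<in> closure \<Theta>" using Y closure_subset by blast
  then obtain \<xi> r where \<xi>: "\<xi> \<in> closure \<Theta>" "strict_mono r" "(Y \<circ> r) \<longlonglongrightarrow> \<xi>"
    using \<open>compact (closure \<Theta>)\<close> unfolding compact_def by blast
  have inv: "(\<lambda>n. inverse (real (Suc (r n)))) \<longlonglongrightarrow> 0"
    using LIMSEQ_subseq_LIMSEQ[OF LIMSEQ_inverse_real_of_nat \<xi>(2)] by (simp add: o_def)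
  have "isCont \<phi> \<xi>" using cont by (simp add: continuous_on_eq_continuous_at)
  then have "(\<lambda>n. \<phi> (Y (r n))) \<longlonglongrightarrow> \<phi> \<xi>"
    using isCont_tendsto_compose[OF _ \<xi>(3)] by (simp add: o_def)
  then have lim: "(\<lambda>n. \<phi> (Y (r n)) + m + inverse (real (Suc (r n)))) \<longlonglongrightarrow> \<phi> \<xi> + m + 0"
    by (intro tendsto_intros inv)
  \<comment> \<open>Near \<xi> the function \<open>u\<close> cannot stay above a level exceeding the
    limit \<open>\<phi> \<xi> + m\<close> of the minimising values. This excludes the frontier and
    also bounds \<open>u \<xi>\<close>. The premise \<open>ax\<close> covers indices at which the
    sequence equals \<xi>, a point the filter omits.\<close>
  have no: False
    if a: "ereal a < Liminf (at \<xi> within \<Theta>) u" "\<phi> \<xi> + m < a" and ax: "\<xi> \<in> \<Theta> \<Longrightarrow> ereal a < u \<xi>" for a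
  proof -
    have "\<forall>\<^sub>F y in at \<xi> within \<Theta>. ereal a < u y"
      using a(1) by (rule less_LiminfD)
    then obtain V where V: "open V" "\<xi> \<in> V" "\<And>y. y \<in> V \<Longrightarrow> y \<noteq> \<xi> \<Longrightarrow> y \<in> \<Theta> \<Longrightarrow> ereal a < u y"
      by (auto simp: eventually_at_topological)
    have "\<forall>\<^sub>F n in sequentially. Y (r n) \<in> V"
      using \<xi>(3) V(1,2) by (auto simp: o_def dest: topological_tendstoD)
    moreover have "\<forall>\<^sub>F n in sequentially. \<phi> (Y (r n)) + m + inverse (real (Suc (r n))) < a"
      using lim a(2) by (intro order_tendstoD(2)) auto
    ultimately have "\<forall>\<^sub>F n in sequentially. False"
    proof eventually_elim
      case (elim n)
      have "ereal a < u (Y (r n))"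
        using V(3)[OF elim(1)] ax Y(1) by (cases "Y (r n) = \<xi>") auto
      also have "\<dots> < ereal (\<phi> (Y (r n)) + m + inverse (real (Suc (r n))))" by (rule Y(2))
      finally show False using elim(2) by simp
    qed
    then show False by simp
  qed
  have "\<xi> \<in> \<Theta>"
  proof (rule ccontr)
    assume n: "\<xi> \<notin> \<Theta>"
    then have "\<xi> \<in> frontier \<Theta>" using \<xi>(1) \<open>open \<Theta>\<close> by (simp add: frontier_def interior_open)
    have "ereal (\<phi> \<xi> + m / 2) < ereal (\<phi> \<xi>)" using m by simp
    also have "\<dots> \<le> Liminf (at \<xi> within \<Theta>) u" by (rule bdry) fact
    finally have "ereal (\<phi> \<xi> + m / 2) < Liminf (at \<xi> within \<Theta>) u" .
    then show False by (rule no) (use m n in auto)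
  qed
  moreover have "u \<xi> \<le> ereal (\<phi> \<xi> + m)"
  proof (rule ccontr)
    assume "\<not> u \<xi> \<le> ereal (\<phi> \<xi> + m)"
    then obtain a where a: "\<phi> \<xi> + m < a" "ereal a < u \<xi>"
      by (metis ereal_dense2 less_ereal.simps(1) not_le)
    have "u \<xi> \<le> Liminf (at \<xi> within \<Theta>) u"
      using lsc \<open>\<xi> \<in> \<Theta>\<close> by (simp add: lower_semicontinuous_on_def)
    then show False using a by (intro no[of a]) auto
  qed
  ultimately show ?thesis
    using m low that[of \<xi> m] antisym by blast
qed

text \<open>If the claim failed, a downward translate of \<phi> would touch \<open>u\<close> at an
  interior minimum of the difference, against strictness. At that minimum \<phi> exceeds
  \<open>u\<close>, so the differential inequality is required only at such points; barriers that
  are good near one boundary point can thus be compared on all of \<Theta>.\<close>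

lemma comparison_with_strict_subsolution:
  fixes \<Theta> :: "((real^'n) \<times> real) set"
  assumes u: "viscosity_supersolution p q \<Theta> u" and "open \<Theta>" "bounded \<Theta>"
    and bdd: "\<And>z. z \<in> \<Theta> \<Longrightarrow> ereal m0 \<le> u z"
    and C2: "C2_derivs UNIV \<phi> D D2"
    and bdry: "\<And>\<xi>. \<xi> \<in> frontier \<Theta> \<Longrightarrow> ereal (\<phi> \<xi>) \<le> Liminf (at \<xi> within \<Theta>) u"
    and sub: "\<And>z. z \<in> \<Theta> \<Longrightarrow> ereal (\<phi> z) \<le> u z \<or>
      space_part (D z) \<noteq> 0 \<and> D z (0, 1) < pq_op p q (D z) (D2 z)"
    and z: "z \<in> \<Theta>"
  shows "ereal (\<phi> z) \<le> u z"
proof (rule ccontr)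
  assume "\<not> ereal (\<phi> z) \<le> u z"
  then have less: "u z < ereal (\<phi> z)" by simp
  have lsc: "lower_semicontinuous_on \<Theta> u"
    using u by (simp add: viscosity_supersolution_def)
  have "continuous_on UNIV \<phi>"
    using C2 unfolding C2_derivs_def by (metis has_derivative_continuous continuous_at_imp_continuous_on)
  then obtain \<xi> m where \<xi>: "\<xi> \<in> \<Theta>" and m: "m < 0" and eq: "u \<xi> = ereal (\<phi> \<xi> + m)"
    and le: "\<And>\<eta>. \<eta> \<in> \<Theta> \<Longrightarrow> ereal (\<phi> \<eta> + m) \<le> u \<eta>"
    using lower_semicontinuous_attains_Inf_diff[OF \<open>bounded \<Theta>\<close> lsc _ bdd bdry \<open>open \<Theta>\<close> z less]
    by blast
  have "\<not> ereal (\<phi> \<xi>) \<le> u \<xi>" using m eq by simp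
  then have s: "space_part (D \<xi>) \<noteq> 0" "D \<xi> (0, 1) < pq_op p q (D \<xi>) (D2 \<xi>)"
    using sub[OF \<xi>] by auto
  have "C2_derivs \<Theta> (\<lambda>z. \<phi> z + m) D D2"
    by (intro C2_derivs_add_const C2_derivs_subset[OF C2]) auto
  from supersolution_touching_test[OF u \<open>open \<Theta>\<close> this \<xi> s(1) eq le] s(2) show False by simp
qed

text \<open>Where \<open>v\<close> is below \<open>c\<close>, the difference of a test function and
  \<open>v\<close> has a local maximum at the contact point, so gradients agree, second derivatives
  are ordered and ellipticity applies. Elsewhere the truncation has its largest value
  \<open>c\<close>, so the test function itself has a local maximum and both its spatial gradient
  and its time derivative vanish.\<close>

lemma viscosity_supersolution_min_const:
  fixes \<Theta> :: "((real^'n) \<times> real) set"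
  assumes p: "p > 1" and "open \<Theta>" and C2: "C2_derivs UNIV v D D2"
    and super: "\<And>z. z \<in> \<Theta> \<Longrightarrow> v z < c \<Longrightarrow>
      space_part (D z) \<noteq> 0 \<and> pq_op p q (D z) (D2 z) \<le> D z (0, 1)"
  shows "viscosity_supersolution p q \<Theta> (\<lambda>z. ereal (min (v z) c))"
proof -
  have "continuous_on UNIV v"
    using C2 unfolding C2_derivs_def by (metis has_derivative_continuous continuous_at_imp_continuous_on)
  then have "((\<lambda>z. ereal (min (v z) c)) \<longlongrightarrow> ereal (min (v \<xi>) c)) (at \<xi> within \<Theta>)" for \<xi>
    by (intro tendsto_intros) (metis continuous_on_def UNIV_I continuous_on_subset subset_UNIV tendsto_within_subset)
  then have lsc: "lower_semicontinuous_on \<Theta> (\<lambda>z. ereal (min (v z) c))"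
    using \<open>open \<Theta>\<close> unfolding lower_semicontinuous_on_def
    by (metis at_within_open lim_imp_Liminf order_refl trivial_limit_at)
  have test: "(space_gradient \<phi> \<xi> \<noteq> 0 \<longrightarrow>
           time_deriv \<phi> \<xi> - pq_laplacian p q (\<lambda>y. \<phi> (y, snd \<xi>)) (fst \<xi>) \<ge> 0) \<and>
        (space_gradient \<phi> \<xi> = 0 \<longrightarrow> time_deriv \<phi> \<xi> \<ge> 0)"
    if \<xi>: "\<xi> \<in> \<Theta>" and E: "C2_derivs \<Theta> \<phi> E E2"
      and t: "touches_from_below \<Theta> \<phi> (\<lambda>z. ereal (min (v z) c)) \<xi>" for \<phi> \<xi> E E2
  proof -
    have t0: "\<phi> \<xi> = min (v \<xi>) c" and tev: "\<forall>\<^sub>F \<eta> in at \<xi>. \<phi> \<eta> < min (v \<eta>) c"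
      using t unfolding touches_from_below_def at_within_open[OF \<xi> \<open>open \<Theta>\<close>]
      by (simp_all only: ereal.inject less_ereal.simps)
    note sp = space_gradient_C2[OF E \<open>open \<Theta>\<close> \<xi>] time_deriv_C2[OF E \<open>open \<Theta>\<close> \<xi>]
      pq_laplacian_C2[OF E \<open>open \<Theta>\<close> \<xi>]
    show ?thesis
    proof (cases "v \<xi> < c")
      case True
      note Cd = C2_derivs_diff[OF E C2_derivs_subset[OF C2 subset_UNIV]]
      have mx: "\<forall>\<^sub>F \<eta> in at \<xi>. \<phi> \<eta> - v \<eta> \<le> \<phi> \<xi> - v \<xi>"
        using tev by eventually_elim (use True t0 in auto)
      have "E \<xi> - D \<xi> = 0" "(E2 \<xi> - D2 \<xi>) h h \<le> 0" for h
        using second_derivative_le_0_at_local_max[OF Cd \<open>open \<Theta>\<close> \<xi> mx] by auto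
      then have eq: "E \<xi> = D \<xi>" and le: "\<And>h. E2 \<xi> h h \<le> D2 \<xi> h h"
        by (auto simp: blinfun.diff_left)
      have s: "space_part (D \<xi>) \<noteq> 0" "pq_op p q (D \<xi>) (D2 \<xi>) \<le> D \<xi> (0, 1)"
        using super[OF \<xi> True] by auto
      have "pq_op p q (D \<xi>) (E2 \<xi>) \<le> pq_op p q (D \<xi>) (D2 \<xi>)"
        by (rule pq_op_mono[OF p s(1) le])
      then show ?thesis using s sp eq by simp
    next
      case False
      have mx: "\<forall>\<^sub>F \<eta> in at \<xi>. \<phi> \<eta> \<le> \<phi> \<xi>"
        using tev by eventually_elim (use False t0 in auto)
      have "E \<xi> = 0" by (rule second_derivative_le_0_at_local_max[OF E \<open>open \<Theta>\<close> \<xi> mx])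
      then show ?thesis using sp(1,2) by (simp add: space_part_def vec_eq_iff)
    qed
  qed
  show ?thesis
    unfolding viscosity_supersolution_def C2_on_iff_C2_derivs
  proof (intro conjI ballI)
    show "\<Theta> \<subseteq> closure {\<xi> \<in> \<Theta>. ereal (min (v \<xi>) c) \<noteq> \<infinity>}"
      using closure_subset[of \<Theta>] by (simp del: ereal_min)
  qed (use lsc test in \<open>blast | simp del: ereal_min\<close>)+
qed

section \<open>Exponential barriers\<close>

text \<open>
  Weight \<open>1\<close> gives barriers that are radial in space-time, weight \<open>0\<close> gives stationary ones.
\<close>
definition time_weight :: "real \<Rightarrow> ((real^'n) \<times> real) \<Rightarrow>\<^sub>L ((real^'n) \<times> real)" where
  "time_weight c = Blinfun (\<lambda>z. (fst z, c * snd z))"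

lemma time_weight_apply [simp]: "time_weight c z = (fst z, c * snd z)"
  unfolding time_weight_def
  by (subst bounded_linear_Blinfun_apply) (auto intro!: bounded_linear_intros)

lemma space_part_inner_right: "space_part (c *\<^sub>R blinfun_inner_right w) = c *\<^sub>R fst w"
  by (simp add: space_part_def vec_eq_iff blinfun.scaleR_left space_unit_def inner_prod_def inner_axis)

text \<open>The rank one term points along the spatial gradient, so it counts once in the trace and
  \<open>p - 2\<close> times in the directional term, which gives \<open>p - 1\<close>; the multiple
  of the identity counts \<open>CARD('n) + p - 2\<close> times. The weight \<open>k\<close> enters
  only in the time direction.\<close>

lemma pq_op_quad:
  fixes w :: "(real^'n) \<times> real"
  assumes c: "c \<noteq> 0" and w: "fst w \<noteq> 0"
  shows "pq_op p q (c *\<^sub>R blinfun_inner_right w)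
    (c *\<^sub>R (Blinfun blinfun_inner_right o\<^sub>L time_weight k) +
      b *\<^sub>R (blinfun_scaleR_left (blinfun_inner_right w) o\<^sub>L blinfun_inner_right w)) =
    norm (c *\<^sub>R fst w) powr (q - 2) *
      (c * (real CARD('n) + p - 2) + b * (p - 1) * (norm (fst w))\<^sup>2)" (is "pq_op p q ?d ?B = _")
proof -
  have B: "?B (h, 0) (h, 0) = c * (h \<bullet> h) + b * (fst w \<bullet> h)\<^sup>2" for h
    by (simp add: blinfun.add_left blinfun.scaleR_left inner_prod_def power2_eq_square
        bounded_linear_Blinfun_apply[OF bounded_linear_blinfun_inner_right])
  have "?B (space_unit i) (space_unit i) = c + b * (fst w $ i)\<^sup>2" for i
    unfolding space_unit_def B by (simp add: inner_axis)
  then have "(\<Sum>i\<in>UNIV. ?B (space_unit i) (space_unit i)) =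
      c * real CARD('n) + b * (\<Sum>i\<in>UNIV. (fst w $ i)\<^sup>2)"
    by (simp add: sum.distrib sum_distrib_left)
  also have "(\<Sum>i\<in>UNIV. (fst w $ i)\<^sup>2) = (norm (fst w))\<^sup>2"
    unfolding power2_norm_eq_inner by (simp add: inner_vec_def power2_eq_square)
  finally have tr: "(\<Sum>i\<in>UNIV. ?B (space_unit i) (space_unit i)) =
      c * real CARD('n) + b * (norm (fst w))\<^sup>2" .
  have "?B (c *\<^sub>R fst w, 0) (c *\<^sub>R fst w, 0) = (norm (c *\<^sub>R fst w))\<^sup>2 * (c + b * (norm (fst w))\<^sup>2)"
    unfolding B by (simp add: dot_square_norm power_mult_distrib algebra_simps power2_eq_square)
  then have "?B (c *\<^sub>R fst w, 0) (c *\<^sub>R fst w, 0) / (norm (c *\<^sub>R fst w))\<^sup>2 = c + b * (norm (fst w))\<^sup>2"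
    using c w by simp
  then show ?thesis
    unfolding pq_op_def space_part_inner_right tr times_divide_eq_right[symmetric]
    by (simp add: algebra_simps)
qed

text \<open>In the last formula the base of the power is the norm of the spatial gradient, written
  as \<alpha> times a factor. That is the shape in which the limit of large \<alpha> is studied, and
  the sign of \<open>B\<close> separates supersolutions from subsolutions.\<close>

lemma exponential_C2_derivs:
  fixes a :: "(real^'n) \<times> real"
  assumes "\<alpha> > 0" "B \<noteq> 0"
  obtains D D2 where "C2_derivs UNIV (\<lambda>z. A + B * exp (- \<alpha> * quad (time_weight c) a z)) D D2"
    "\<And>z. fst z \<noteq> fst a \<Longrightarrow> space_part (D z) \<noteq> 0"
    "\<And>z. D z (0, 1) =
      - 2 * \<alpha> * (B * exp (- \<alpha> * quad (time_weight c) a z)) * (c * (snd z - snd a))"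
    "\<And>z. fst z \<noteq> fst a \<Longrightarrow> pq_op p q (D z) (D2 z) =
      B * exp (- \<alpha> * quad (time_weight c) a z) *
      ((\<alpha> * (2 * \<bar>B\<bar> * exp (- \<alpha> * quad (time_weight c) a z) * norm (fst z - fst a))) powr (q - 2) *
       (4 * \<alpha>\<^sup>2 * (p - 1) * (norm (fst z - fst a))\<^sup>2 - 2 * \<alpha> * (real CARD('n) + p - 2)))"
proof -
  let ?T = "time_weight c :: ((real^'n) \<times> real) \<Rightarrow>\<^sub>L _"
  let ?e = "\<lambda>z. B * exp (- \<alpha> * quad ?T a z)"
  let ?w = "\<lambda>z. blinfun_inner_right (?T (z - a))"
  let ?D = "\<lambda>z. (2 * (- \<alpha> * ?e z)) *\<^sub>R ?w z"
  let ?D2 = "\<lambda>z. (2 * (- \<alpha> * ?e z)) *\<^sub>R (Blinfun blinfun_inner_right o\<^sub>L ?T) +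
    (4 * (\<alpha>\<^sup>2 * ?e z)) *\<^sub>R (blinfun_scaleR_left (?w z) o\<^sub>L ?w z)"
  show ?thesis
  proof (rule that[of ?D ?D2])
    show "C2_derivs UNIV (\<lambda>z. A + B * exp (- \<alpha> * quad ?T a z)) ?D ?D2"
      by (rule C2_derivs_quad[where g = "\<lambda>s. A + B * exp (- \<alpha> * s)"
            and g' = "\<lambda>s. - \<alpha> * (B * exp (- \<alpha> * s))" and g'' = "\<lambda>s. \<alpha>\<^sup>2 * (B * exp (- \<alpha> * s))"])
        (auto intro!: derivative_eq_intros continuous_intros simp: inner_prod_def power2_eq_square)
  next
    fix z
    show "space_part (?D z) \<noteq> 0" if "fst z \<noteq> fst a"
      unfolding space_part_inner_right using that assms by simp
    show "?D z (0, 1) = - 2 * \<alpha> * ?e z * (c * (snd z - snd a))"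
      by (simp add: blinfun.minus_left blinfun.scaleR_left inner_prod_def)
    assume nz: "fst z \<noteq> fst a"
    have "pq_op p q (?D z) (?D2 z) = norm ((2 * (- \<alpha> * ?e z)) *\<^sub>R (fst (?T (z - a)))) powr (q - 2) *
      (2 * (- \<alpha> * ?e z) * (real CARD('n) + p - 2) +
       4 * (\<alpha>\<^sup>2 * ?e z) * (p - 1) * (norm (fst (?T (z - a))))\<^sup>2)"
      by (rule pq_op_quad) (use nz assms in auto)
    also have "norm ((2 * (- \<alpha> * ?e z)) *\<^sub>R (fst (?T (z - a)))) =
        \<alpha> * (2 * \<bar>B\<bar> * exp (- \<alpha> * quad ?T a z) * norm (fst z - fst a))"
      using assms by (simp add: abs_mult)
    finally show "pq_op p q (?D z) (?D2 z) =
      ?e z * ((\<alpha> * (2 * \<bar>B\<bar> * exp (- \<alpha> * quad ?T a z) * norm (fst z - fst a))) powr (q - 2) *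
       (4 * \<alpha>\<^sup>2 * (p - 1) * (norm (fst z - fst a))\<^sup>2 - 2 * \<alpha> * (real CARD('n) + p - 2)))"
      by (simp add: algebra_simps)
  qed
qed

text \<open>For each \<open>K > 0\<close>, comparison with a stationary exponential whose values lie
  between \<open>b - K\<close> and \<open>b\<close> gives \<open>b - K\<close> as a lower bound;
  then \<open>K\<close> tends to zero. The exponential is a strict subsolution because its operator
  is positive and its time derivative zero.\<close>

lemma supersolution_minimum_principle:
  fixes \<Theta> :: "((real^'n) \<times> real) set"
  assumes p: "p > 1" and u: "viscosity_supersolution p q \<Theta> u" and "open \<Theta>" and bd: "bounded \<Theta>"
    and bdd: "\<And>z. z \<in> \<Theta> \<Longrightarrow> ereal m0 \<le> u z"
    and bdry: "\<And>\<xi>. \<xi> \<in> frontier \<Theta> \<Longrightarrow> ereal b \<le> Liminf (at \<xi> within \<Theta>) u"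
    and z: "z \<in> \<Theta>"
  shows "ereal b \<le> u z"
proof -
  let ?N = "real CARD('n) + p - 2"
  obtain C where C: "\<And>y. y \<in> \<Theta> \<Longrightarrow> norm y \<le> C" using bd by (auto simp: bounded_iff)
  have C0: "C \<ge> 0" using C[OF z] norm_ge_zero order_trans by blast
  have N: "?N > 0"
  proof -
    have "real CARD('n) \<ge> 1" by (simp add: Suc_leI)
    then show ?thesis using p by linarith
  qed
  \<comment> \<open>All points of \<Theta> have norm at most \<open>C\<close>, so this centre,
    placed along an arbitrary coordinate axis, has spatial distance at least 1 from each of
    them.\<close>
  define a where "a = ((C + 1) *\<^sub>R axis undefined 1 :: real^'n, 0::real)"
  have far: "norm (fst y - fst a) \<ge> 1" if "y \<in> \<Theta>" for y
  proof -
    have "norm (fst a) \<le> norm (fst y) + norm (fst y - fst a)"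
      using norm_triangle_ineq2[of "fst a" "fst y"] by (simp add: norm_minus_commute)
    moreover have "norm (fst y) \<le> C"
      using C[OF that] norm_fst_le[of "fst y" "snd y"] by simp
    moreover have "norm (fst a) = C + 1" using C0 by (simp add: a_def)
    ultimately show ?thesis by simp
  qed
  \<comment> \<open>This choice turns the bracket of the operator into
    \<open>2 * \<alpha> * ?N * (2 * \<rho>\<^sup>2 - 1)\<close> with \<rho> the spatial distance to
    \<open>a\<close>, which is positive for \<rho> at least 1. It does not depend on
    \<open>K\<close>.\<close>
  define \<alpha> where "\<alpha> = ?N / (p - 1)"
  have \<alpha>: "\<alpha> > 0" "\<alpha> * (p - 1) = ?N" using N p by (auto simp: \<alpha>_def)
  have ge: "ereal (b - K) \<le> u z" if K: "K > 0" for K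
  proof -
    define \<phi> where "\<phi> y = (b - K) + K * exp (- \<alpha> * quad (time_weight 0) a y)" for y
    have q0: "quad (time_weight 0) a y \<ge> 0" for y
      by (simp add: quad_def inner_prod_def)
    have \<phi>b: "\<phi> y \<le> b" "b - K \<le> \<phi> y" for y
      using K \<alpha> q0[of y] mult_left_mono[of "exp (- \<alpha> * quad (time_weight 0) a y)" 1 K]
      by (auto simp: \<phi>_def)
    obtain D D2 where D: "C2_derivs UNIV \<phi> D D2"
      "\<And>z. fst z \<noteq> fst a \<Longrightarrow> space_part (D z) \<noteq> 0"
      "\<And>z. D z (0, 1) = - 2 * \<alpha> * (K * exp (- \<alpha> * quad (time_weight 0) a z)) * (0 * (snd z - snd a))"
      "\<And>z. fst z \<noteq> fst a \<Longrightarrow> pq_op p q (D z) (D2 z) =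
        K * exp (- \<alpha> * quad (time_weight 0) a z) *
        ((\<alpha> * (2 * \<bar>K\<bar> * exp (- \<alpha> * quad (time_weight 0) a z) * norm (fst z - fst a))) powr (q - 2) *
         (4 * \<alpha>\<^sup>2 * (p - 1) * (norm (fst z - fst a))\<^sup>2 - 2 * \<alpha> * ?N))"
      unfolding \<phi>_def
      by (rule exponential_C2_derivs[of \<alpha> K "b - K" 0 a p q]) (use \<alpha> K in auto)
    have "ereal (\<phi> z) \<le> u z"
    proof (rule comparison_with_strict_subsolution[OF u \<open>open \<Theta>\<close> bd bdd D(1) _ _ z])
      show "ereal (\<phi> \<xi>) \<le> Liminf (at \<xi> within \<Theta>) u" if "\<xi> \<in> frontier \<Theta>" for \<xi>
        using bdry[OF that] \<phi>b(1)[of \<xi>] by (meson ereal_less_eq(3) order_trans)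
    next
      fix y assume y: "y \<in> \<Theta>"
      have f: "norm (fst y - fst a) \<ge> 1" by (rule far[OF y])
      then have ne: "fst y \<noteq> fst a" by auto
      have "4 * \<alpha>\<^sup>2 * (p - 1) * (norm (fst y - fst a))\<^sup>2 - 2 * \<alpha> * ?N
          = 2 * \<alpha> * ?N * (2 * (norm (fst y - fst a))\<^sup>2 - 1)"
        unfolding \<alpha>(2)[symmetric] by (simp add: power2_eq_square algebra_simps)
      moreover have "(norm (fst y - fst a))\<^sup>2 \<ge> 1" using f by simp
      ultimately have "4 * \<alpha>\<^sup>2 * (p - 1) * (norm (fst y - fst a))\<^sup>2 - 2 * \<alpha> * ?N > 0"
        using \<alpha>(1) N by simp
      then have "pq_op p q (D y) (D2 y) > 0"
        unfolding D(4)[OF ne] using K \<alpha> ne by (intro mult_pos_pos) auto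
      then show "ereal (\<phi> y) \<le> u y \<or> space_part (D y) \<noteq> 0 \<and> D y (0, 1) < pq_op p q (D y) (D2 y)"
        using D(2)[OF ne] D(3)[of y] by simp
    qed
    then show ?thesis using \<phi>b(2)[of z] by (meson ereal_less_eq(3) order_trans)
  qed
  show ?thesis
  proof (rule ccontr)
    assume "\<not> ereal b \<le> u z"
    then obtain s where s: "u z < ereal s" "s < b"
      by (metis ereal_dense2 less_ereal.simps(1) not_le)
    have "ereal (b - (b - s)) \<le> u z" using s(2) by (intro ge) simp
    then show False using s(1) by simp
  qed
qed

text \<open>The right-hand side grows at least like \<open>\<alpha> powr q\<close>, uniformly in
  \<open>a\<close> and \<rho>, while the left-hand side is linear in \<alpha>; \<open>q > 1\<close>
  decides.\<close>

lemma eventually_diffusion_dominates: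
  fixes p q N a0 a1 \<rho>0 \<tau> :: real
  assumes p: "p > 1" and q: "q > 1" and "0 < a0" "a0 \<le> a1" "0 < \<rho>0"
  shows "\<forall>\<^sub>F \<alpha> in at_top. \<forall>a \<rho>. a0 \<le> a \<and> a \<le> a1 \<and> \<rho>0 \<le> \<rho> \<longrightarrow>
    2 * \<alpha> * \<tau> < (\<alpha> * a) powr (q - 2) * (4 * \<alpha>\<^sup>2 * (p - 1) * \<rho>\<^sup>2 - 2 * \<alpha> * N)"
proof -
  \<comment> \<open>The power is monotone in \<open>a\<close>, in a direction given by the sign of
    \<open>q - 2\<close>, so its minimum over the interval lies at an endpoint.\<close>
  define c where "c = min (a0 powr (q - 2)) (a1 powr (q - 2))"
  have c: "c > 0" using assms by (simp add: c_def)
  have ca: "c \<le> a powr (q - 2)" if "a0 \<le> a" "a \<le> a1" for a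
  proof (cases "q \<ge> 2")
    case True
    then have "a0 powr (q - 2) \<le> a powr (q - 2)" using that assms by (intro powr_mono2) auto
    then show ?thesis by (simp add: c_def)
  next
    case False
    then have "a1 powr (q - 2) \<le> a powr (q - 2)" using that assms by (intro powr_mono2') auto
    then show ?thesis by (simp add: c_def)
  qed
  have pr: "(p - 1) * \<rho>0\<^sup>2 > 0" using assms by simp
  \<comment> \<open>Beyond this threshold the term with \<open>N\<close> consumes at most half of
    the quadratic term.\<close>
  have e1: "\<forall>\<^sub>F \<alpha> in at_top. \<alpha> > max 0 (N / ((p - 1) * \<rho>0\<^sup>2))" by (rule eventually_gt_at_top)
  \<comment> \<open>The maximum with 1 keeps \<open>T\<close> positive, so that the powers with
    exponents \<open>1 / (q - 1)\<close> and \<open>q - 1\<close> cancel even when \<tau> is not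
    positive.\<close>
  define T where "T = max 1 (\<tau> / (c * ((p - 1) * \<rho>0\<^sup>2)))"
  have e2: "\<forall>\<^sub>F \<alpha> in at_top. \<alpha> > T powr (1 / (q - 1))" by (rule eventually_gt_at_top)
  show ?thesis
    using e1 e2
  proof (eventually_elim, intro allI impI)
    case (elim \<alpha>)
    fix a \<rho> assume a: "a0 \<le> a \<and> a \<le> a1 \<and> \<rho>0 \<le> \<rho>"
    have \<alpha>: "\<alpha> > 0" and N: "N < \<alpha> * ((p - 1) * \<rho>0\<^sup>2)"
      using elim(1) pr by (auto simp: pos_divide_less_eq)
    have "(T powr (1 / (q - 1))) powr (q - 1) < \<alpha> powr (q - 1)"
      using elim(2) q by (intro powr_less_mono2) auto
    moreover have "(T powr (1 / (q - 1))) powr (q - 1) = T"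
      using q by (simp add: powr_powr T_def)
    ultimately have "\<tau> / (c * ((p - 1) * \<rho>0\<^sup>2)) < \<alpha> powr (q - 1)" by (simp add: T_def)
    then have \<tau>: "\<tau> < \<alpha> powr (q - 1) * (c * ((p - 1) * \<rho>0\<^sup>2))"
      using c pr by (subst (asm) pos_divide_less_eq) auto
    have "\<rho>0\<^sup>2 \<le> \<rho>\<^sup>2" using a assms by (intro power_mono) auto
    then have "(p - 1) * \<rho>0\<^sup>2 \<le> (p - 1) * \<rho>\<^sup>2" using p by simp
    then have "\<alpha> * ((p - 1) * \<rho>0\<^sup>2) \<le> \<alpha> * ((p - 1) * \<rho>\<^sup>2)" using \<alpha> by simp
    then have "\<alpha> * ((p - 1) * \<rho>0\<^sup>2) \<le> 2 * (\<alpha> * ((p - 1) * \<rho>\<^sup>2)) - N" using N by linarith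
    then have "2 * \<alpha> * (\<alpha> * ((p - 1) * \<rho>0\<^sup>2)) \<le> 2 * \<alpha> * (2 * (\<alpha> * ((p - 1) * \<rho>\<^sup>2)) - N)"
      using \<alpha> by (intro mult_left_mono) auto
    also have "\<dots> = 4 * \<alpha>\<^sup>2 * (p - 1) * \<rho>\<^sup>2 - 2 * \<alpha> * N"
      by (simp add: power2_eq_square algebra_simps)
    finally have L: "2 * \<alpha> * (\<alpha> * ((p - 1) * \<rho>0\<^sup>2)) \<le> 4 * \<alpha>\<^sup>2 * (p - 1) * \<rho>\<^sup>2 - 2 * \<alpha> * N" .
    have "\<alpha> powr (q - 1) = \<alpha> powr (q - 2) * \<alpha>"
      using \<alpha> powr_add[of \<alpha> "q - 2" 1] by simp
    then have "2 * \<alpha> * \<tau> < 2 * \<alpha> * (\<alpha> powr (q - 2) * \<alpha> * (c * ((p - 1) * \<rho>0\<^sup>2)))"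
      using \<tau> \<alpha> by simp
    also have "\<dots> = (\<alpha> powr (q - 2) * c) * (2 * \<alpha> * (\<alpha> * ((p - 1) * \<rho>0\<^sup>2)))" by simp
    also have "\<dots> \<le> (\<alpha> powr (q - 2) * a powr (q - 2)) * (2 * \<alpha> * (\<alpha> * ((p - 1) * \<rho>0\<^sup>2)))"
      using ca a \<alpha> pr by (intro mult_right_mono mult_left_mono) auto
    also have "\<alpha> powr (q - 2) * a powr (q - 2) = (\<alpha> * a) powr (q - 2)"
      using \<alpha> a assms by (simp add: powr_mult)
    also have "(\<alpha> * a) powr (q - 2) * (2 * \<alpha> * (\<alpha> * ((p - 1) * \<rho>0\<^sup>2)))
        \<le> (\<alpha> * a) powr (q - 2) * (4 * \<alpha>\<^sup>2 * (p - 1) * \<rho>\<^sup>2 - 2 * \<alpha> * N)"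
      using L by (intro mult_left_mono) auto
    finally show "2 * \<alpha> * \<tau> < (\<alpha> * a) powr (q - 2) * (4 * \<alpha>\<^sup>2 * (p - 1) * \<rho>\<^sup>2 - 2 * \<alpha> * N)" .
  qed
qed

section \<open>The barrier at a point of the exterior ball\<close>

lemma quad_time_weight_1: "quad (time_weight 1) a z = (norm (z - a))\<^sup>2"
proof -
  have "time_weight 1 (z - a) = z - a" by (simp add: prod_eq_iff)
  then show ?thesis by (simp only: quad_def dot_square_norm)
qed

text \<open>
  The barrier is centred at the midpoint of \<open>z0\<close> and \<open>z1\<close>: the ball of half the radius touches the
  closure of \<open>\<Theta>\<close> only at \<open>z0\<close>, so that a large \<open>\<alpha>\<close> confines \<open>{h < K / 2}\<close> to a small
  neighbourhood of \<open>z0\<close>. There the exponential factor lies between \<open>1/2\<close> and \<open>1\<close>, so the diffusion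
  term is of order \<open>\<alpha> powr q\<close> and beats the time derivative, which is of order \<open>\<alpha>\<close>.
\<close>
lemma exterior_ball_barrier:
  fixes \<Theta> :: "((real^'n) \<times> real) set"
  assumes p: "p > 1" and q: "q > 1" and bd: "bounded \<Theta>"
    and disj: "ball z1 R \<inter> \<Theta> = {}" and R: "dist z1 z0 = R" and ne: "fst z1 \<noteq> fst z0"
    and K: "K > 0" and r: "r > 0"
  obtains h where "continuous_on UNIV h" "h z0 = 0"
    "\<And>z. z \<in> closure \<Theta> \<Longrightarrow> 0 \<le> h z"
    "\<And>z. z \<in> closure \<Theta> \<Longrightarrow> h z < K / 2 \<Longrightarrow> dist z z0 < r"
    "\<And>c. \<exists>D D2. C2_derivs UNIV (\<lambda>z. c + h z) D D2 \<and>
      (\<forall>z\<in>\<Theta>. h z < K / 2 \<longrightarrow> space_part (D z) \<noteq> 0 \<and> pq_op p q (D z) (D2 z) \<le> D z (0, 1))"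
    "\<And>c. \<exists>D D2. C2_derivs UNIV (\<lambda>z. c - h z) D D2 \<and>
      (\<forall>z\<in>\<Theta>. h z < K / 2 \<longrightarrow> space_part (D z) \<noteq> 0 \<and> D z (0, 1) < pq_op p q (D z) (D2 z))"
proof -
  define a where "a = midpoint z0 z1"
  define S where "S = (norm (z0 - a))\<^sup>2"
  define l where "l = norm (fst z0 - fst a)"
  have fa: "fst a = (1/2) *\<^sub>R (fst z0 + fst z1)"
    by (simp add: a_def midpoint_def)
  then have "fst z0 - fst a = (1/2) *\<^sub>R (fst z0 - fst z1)"
    by (simp add: algebra_simps flip: scaleR_left.add)
  then have l: "l > 0" using ne by (simp add: l_def)
  \<comment> \<open>Within \<open>l / 2\<close> of \<open>z0\<close> the spatial distance to
    \<open>a\<close> remains at least \<open>l / 2\<close>, which keeps the spatial gradient away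
    from zero.\<close>
  define r' where "r' = min r (l / 2)"
  have r': "r' > 0" using r l by (simp add: r'_def)
  obtain C0 where C0: "\<And>z. z \<in> \<Theta> \<Longrightarrow> norm z \<le> C0" using bd by (auto simp: bounded_iff)
  \<comment> \<open>A bound for the distance from \<open>a\<close> on \<Theta>; the maximum with
    \<open>l\<close> ensures that the range of \<open>b\<close> below is not empty.\<close>
  define C where "C = max l (C0 + norm a)"
  have Ca: "norm (z - a) \<le> C" if "z \<in> \<Theta>" for z
    using C0[OF that] norm_triangle_ineq4[of z a] by (simp add: C_def)
  \<comment> \<open>Apollonius' identity for the midpoint \<open>a\<close>, combined with
    \<open>z\<close> lying outside the large ball: moving away from \<open>z0\<close> costs squared
    distance to \<open>a\<close> quadratically.\<close>
  have cl: "(norm (z - z0))\<^sup>2 \<le> 2 * ((norm (z - a))\<^sup>2 - S)" if "z \<in> closure \<Theta>" for z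
  proof -
    have "ball z1 R \<inter> closure \<Theta> = {}" using disj by (simp add: open_Int_closure_eq_empty)
    then have "z \<notin> ball z1 R" using that by blast
    then have "dist z1 z \<ge> R" by simp
    then have "(norm (z - z1))\<^sup>2 \<ge> (norm (z0 - z1))\<^sup>2"
      using R by (intro power_mono) (auto simp: dist_norm norm_minus_commute)
    moreover have "(norm (z - z0))\<^sup>2 + (norm (z - z1))\<^sup>2 - (norm (z0 - z1))\<^sup>2 =
        2 * ((norm (z - a))\<^sup>2 - S)"
      unfolding S_def a_def midpoint_def power2_norm_eq_inner
      by (simp add: algebra_simps inner_commute)
    ultimately show ?thesis by linarith
  qed
  \<comment> \<open>Here \<open>b\<close> stands for \<open>2 * (K * e z) * \<rho>\<close>, the norm
    of the spatial gradient divided by \<alpha>, with the exponential \<open>e z\<close> between 1/2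
    and 1 and \<rho> between \<open>l / 2\<close> and \<open>C\<close>.\<close>
  have "\<forall>\<^sub>F \<alpha> in at_top. \<forall>b \<rho>. K * (l / 2) \<le> b \<and> b \<le> 2 * K * C \<and> l / 2 \<le> \<rho> \<longrightarrow>
    2 * \<alpha> * C < (\<alpha> * b) powr (q - 2) * (4 * \<alpha>\<^sup>2 * (p - 1) * \<rho>\<^sup>2 - 2 * \<alpha> * (real CARD('n) + p - 2))"
  proof (rule eventually_diffusion_dominates[OF p q])
    have "l \<le> C" by (simp add: C_def)
    then have "l / 2 \<le> 2 * C" using l by linarith
    then have "K * (l / 2) \<le> K * (2 * C)" using K by (intro mult_left_mono) auto
    then show "K * (l / 2) \<le> 2 * K * C" by (simp only: mult_ac)
  qed (use K l in auto)
  \<comment> \<open>By \<open>cl\<close> the exponential is at most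
    \<open>exp (- \<alpha> * r'\<^sup>2 / 2)\<close> at distance \<open>r'\<close> or more from
    \<open>z0\<close>; this threshold makes that less than 1/2.\<close>
  moreover have "\<forall>\<^sub>F \<alpha> in at_top. \<alpha> > 2 * ln 2 / r'\<^sup>2" by (rule eventually_gt_at_top)
  ultimately have "\<forall>\<^sub>F \<alpha> in at_top. \<alpha> > 2 * ln 2 / r'\<^sup>2 \<and>
    (\<forall>b \<rho>. K * (l / 2) \<le> b \<and> b \<le> 2 * K * C \<and> l / 2 \<le> \<rho> \<longrightarrow>
    2 * \<alpha> * C < (\<alpha> * b) powr (q - 2) * (4 * \<alpha>\<^sup>2 * (p - 1) * \<rho>\<^sup>2 - 2 * \<alpha> * (real CARD('n) + p - 2)))"
    by eventually_elim blast
  then obtain \<alpha> where \<alpha>r: "\<alpha> > 2 * ln 2 / r'\<^sup>2" and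
    dom: "\<And>b \<rho>. K * (l / 2) \<le> b \<Longrightarrow> b \<le> 2 * K * C \<Longrightarrow> l / 2 \<le> \<rho> \<Longrightarrow>
    2 * \<alpha> * C < (\<alpha> * b) powr (q - 2) * (4 * \<alpha>\<^sup>2 * (p - 1) * \<rho>\<^sup>2 - 2 * \<alpha> * (real CARD('n) + p - 2))"
    using eventually_happens trivial_limit_at_top_linorder by (metis (no_types, lifting))
  have "2 * ln 2 / r'\<^sup>2 > (0::real)" using r' by simp
  then have \<alpha>: "\<alpha> > 0" using \<alpha>r by linarith
  define e where "e z = exp (\<alpha> * (S - (norm (z - a))\<^sup>2))" for z
  define h where "h z = K - K * e z" for z
  \<comment> \<open>The factor \<open>exp (\<alpha> * S)\<close> normalises the exponential to 1 at
    \<open>z0\<close>, so that \<open>h z0 = 0\<close>.\<close>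
  have e_eq: "K * exp (\<alpha> * S) * exp (- \<alpha> * quad (time_weight 1) a z) = K * e z" for z
    unfolding e_def quad_time_weight_1 by (simp add: algebra_simps flip: exp_add)
  have e1: "e z \<le> 1" if "z \<in> closure \<Theta>" for z
  proof -
    have "0 \<le> 2 * ((norm (z - a))\<^sup>2 - S)" using zero_le_power2 cl[OF that] by (rule order_trans)
    then show ?thesis using \<alpha> by (simp add: e_def mult_nonneg_nonpos)
  qed
  have e_half: "e z > 1/2" if "h z < K / 2" for z
  proof -
    have "K * (1/2) < K * e z" using that by (simp add: h_def)
    then show ?thesis using K by simp
  qed
  have near: "dist z z0 < r'" if z: "z \<in> closure \<Theta>" "h z < K / 2" for z
  proof -
    have "ln (1/2) < \<alpha> * (S - (norm (z - a))\<^sup>2)"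
      using e_half[OF z(2)] unfolding e_def by (metis exp_gt_zero exp_ln less_trans half_gt_zero exp_less_cancel_iff zero_less_one)
    then have "\<alpha> * ((norm (z - a))\<^sup>2 - S) < ln 2" by (simp add: ln_div algebra_simps)
    moreover have "ln 2 < \<alpha> * (r'\<^sup>2 / 2)" using \<alpha>r r' by (simp add: field_simps)
    ultimately have "(norm (z - a))\<^sup>2 - S < r'\<^sup>2 / 2" using \<alpha> by (metis less_trans mult_less_cancel_left_pos)
    then have "2 * ((norm (z - a))\<^sup>2 - S) < r'\<^sup>2" by (simp add: field_simps)
    with cl[OF z(1)] have "(norm (z - z0))\<^sup>2 < r'\<^sup>2" by (rule le_less_trans)
    then show ?thesis using r' by (simp add: dist_norm power2_less_imp_less)
  qed
  have geo: "fst z \<noteq> fst a" "2 * \<alpha> * \<bar>snd z - snd a\<bar> < (\<alpha> * (2 * (K * e z) * norm (fst z - fst a))) powr (q - 2) *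
      (4 * \<alpha>\<^sup>2 * (p - 1) * (norm (fst z - fst a))\<^sup>2 - 2 * \<alpha> * (real CARD('n) + p - 2))"
    if z: "z \<in> \<Theta>" "h z < K / 2" for z
  proof -
    have zc: "z \<in> closure \<Theta>" using z closure_subset by blast
    have "norm (fst z - fst z0) \<le> norm (z - z0)"
      by (metis fst_diff norm_fst_le prod.collapse)
    then have "norm (fst z - fst z0) < l / 2"
      using near[OF zc z(2)] by (simp add: dist_norm r'_def)
    moreover have "l \<le> norm (fst z - fst z0) + norm (fst z - fst a)"
      unfolding l_def by (metis norm_minus_commute norm_triangle_ineq diff_add_cancel add_diff_eq)
    ultimately have \<rho>: "l / 2 \<le> norm (fst z - fst a)" by simp
    then show "fst z \<noteq> fst a" using l by auto
    have "norm (fst z - fst a) \<le> norm (z - a)" "\<bar>snd z - snd a\<bar> \<le> norm (z - a)"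
      by (metis fst_diff norm_fst_le prod.collapse) (metis snd_diff norm_snd_le prod.collapse real_norm_def)
    then have u: "norm (fst z - fst a) \<le> C" "\<bar>snd z - snd a\<bar> \<le> C" using Ca[OF z(1)] by auto
    have "K * (1/2) \<le> K * e z" "K * e z \<le> K * 1"
      using e_half[OF z(2)] e1[OF zc] K by (intro mult_left_mono; simp)+
    then have Ke: "K / 2 \<le> K * e z" "K * e z \<le> K" by auto
    have "(K / 2) * (l / 2) \<le> (K * e z) * norm (fst z - fst a)"
      by (rule mult_mono) (use Ke \<rho> l K in auto)
    moreover have "(K * e z) * norm (fst z - fst a) \<le> K * C"
      by (rule mult_mono) (use Ke u K in auto)
    ultimately have "2 * \<alpha> * C < (\<alpha> * (2 * (K * e z) * norm (fst z - fst a))) powr (q - 2) *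
      (4 * \<alpha>\<^sup>2 * (p - 1) * (norm (fst z - fst a))\<^sup>2 - 2 * \<alpha> * (real CARD('n) + p - 2))"
      by (intro dom \<rho>) auto
    moreover have "2 * \<alpha> * \<bar>snd z - snd a\<bar> \<le> 2 * \<alpha> * C" using u \<alpha> by simp
    ultimately show "2 * \<alpha> * \<bar>snd z - snd a\<bar> < (\<alpha> * (2 * (K * e z) * norm (fst z - fst a))) powr (q - 2) *
      (4 * \<alpha>\<^sup>2 * (p - 1) * (norm (fst z - fst a))\<^sup>2 - 2 * \<alpha> * (real CARD('n) + p - 2))"
      by linarith
  qed
  define P where "P z = (\<alpha> * (2 * (K * e z) * norm (fst z - fst a))) powr (q - 2) *
      (4 * \<alpha>\<^sup>2 * (p - 1) * (norm (fst z - fst a))\<^sup>2 - 2 * \<alpha> * (real CARD('n) + p - 2))" for z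
  \<comment> \<open>The operator and the time derivative of \<open>c + h\<close> are the negatives
    of those of \<open>c - h\<close>, so this one inequality serves both barriers.\<close>
  have Ppos: "- (2 * \<alpha> * (snd z - snd a)) < P z" if "z \<in> \<Theta>" "h z < K / 2" for z
  proof -
    have "2 * \<alpha> * \<bar>snd z - snd a\<bar> < P z" unfolding P_def by (rule geo(2)[OF that])
    moreover have "- (2 * \<alpha> * (snd z - snd a)) \<le> 2 * \<alpha> * \<bar>snd z - snd a\<bar>"
      using \<alpha> by (simp add: abs_if algebra_simps)
    ultimately show ?thesis by linarith
  qed
  have Ke0: "K * e z > 0" for z using K by (simp add: e_def)
  show ?thesis
  proof (rule that[of h])
    show "continuous_on UNIV h" unfolding h_def e_def by (intro continuous_intros)
    show "h z0 = 0" by (simp add: h_def e_def S_def)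
    show "0 \<le> h z" if "z \<in> closure \<Theta>" for z using e1[OF that] K by (simp add: h_def)
    show "dist z z0 < r" if "z \<in> closure \<Theta>" "h z < K / 2" for z
      using near[OF that] by (simp add: r'_def)
  next
    fix c
    have B: "- (K * exp (\<alpha> * S)) \<noteq> 0" using K by simp
    obtain D D2 where D: "C2_derivs UNIV (\<lambda>z. (c + K) + - (K * exp (\<alpha> * S)) * exp (- \<alpha> * quad (time_weight 1) a z)) D D2"
      "\<And>z. fst z \<noteq> fst a \<Longrightarrow> space_part (D z) \<noteq> 0"
      "\<And>z. D z (0, 1) = - 2 * \<alpha> * (- (K * exp (\<alpha> * S)) * exp (- \<alpha> * quad (time_weight 1) a z)) * (1 * (snd z - snd a))"
      "\<And>z. fst z \<noteq> fst a \<Longrightarrow> pq_op p q (D z) (D2 z) =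
        - (K * exp (\<alpha> * S)) * exp (- \<alpha> * quad (time_weight 1) a z) *
        ((\<alpha> * (2 * \<bar>- (K * exp (\<alpha> * S))\<bar> * exp (- \<alpha> * quad (time_weight 1) a z) * norm (fst z - fst a))) powr (q - 2) *
         (4 * \<alpha>\<^sup>2 * (p - 1) * (norm (fst z - fst a))\<^sup>2 - 2 * \<alpha> * (real CARD('n) + p - 2)))"
      by (rule exponential_C2_derivs[OF \<alpha> B, of "c + K" 1 a p q]) blast
    have ab: "2 * \<bar>- (K * exp (\<alpha> * S))\<bar> * exp (- \<alpha> * quad (time_weight 1) a z) = 2 * (K * e z)" for z
      using K e_eq[of z] by (simp add: abs_mult)
    have me: "- (K * exp (\<alpha> * S)) * exp (- \<alpha> * quad (time_weight 1) a z) = - (K * e z)" for z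
      using e_eq[of z] by simp
    have "C2_derivs UNIV (\<lambda>z. c + h z) D D2"
      using D(1) unfolding me by (simp add: h_def add_diff_eq)
    moreover have "space_part (D z) \<noteq> 0 \<and> pq_op p q (D z) (D2 z) \<le> D z (0, 1)"
      if z: "z \<in> \<Theta>" "h z < K / 2" for z
    proof -
      note ne = geo(1)[OF z]
      have "K * e z * - (2 * \<alpha> * (snd z - snd a)) \<le> K * e z * P z"
        using Ppos[OF z] Ke0[of z] by (intro mult_left_mono) auto
      moreover have "pq_op p q (D z) (D2 z) = - (K * e z * P z)"
        unfolding D(4)[OF ne] me ab P_def by simp
      moreover have "D z (0, 1) = - (K * e z * - (2 * \<alpha> * (snd z - snd a)))"
        unfolding D(3) me by simp
      ultimately show ?thesis using D(2)[OF ne] by linarith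
    qed
    ultimately show "\<exists>D D2. C2_derivs UNIV (\<lambda>z. c + h z) D D2 \<and>
      (\<forall>z\<in>\<Theta>. h z < K / 2 \<longrightarrow> space_part (D z) \<noteq> 0 \<and> pq_op p q (D z) (D2 z) \<le> D z (0, 1))"
      by blast
  next
    fix c
    have B: "K * exp (\<alpha> * S) \<noteq> 0" using K by simp
    obtain D D2 where D: "C2_derivs UNIV (\<lambda>z. (c - K) + K * exp (\<alpha> * S) * exp (- \<alpha> * quad (time_weight 1) a z)) D D2"
      "\<And>z. fst z \<noteq> fst a \<Longrightarrow> space_part (D z) \<noteq> 0"
      "\<And>z. D z (0, 1) = - 2 * \<alpha> * (K * exp (\<alpha> * S) * exp (- \<alpha> * quad (time_weight 1) a z)) * (1 * (snd z - snd a))"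
      "\<And>z. fst z \<noteq> fst a \<Longrightarrow> pq_op p q (D z) (D2 z) =
        K * exp (\<alpha> * S) * exp (- \<alpha> * quad (time_weight 1) a z) *
        ((\<alpha> * (2 * \<bar>K * exp (\<alpha> * S)\<bar> * exp (- \<alpha> * quad (time_weight 1) a z) * norm (fst z - fst a))) powr (q - 2) *
         (4 * \<alpha>\<^sup>2 * (p - 1) * (norm (fst z - fst a))\<^sup>2 - 2 * \<alpha> * (real CARD('n) + p - 2)))"
      by (rule exponential_C2_derivs[OF \<alpha> B, of "c - K" 1 a p q]) blast
    have ab: "2 * \<bar>K * exp (\<alpha> * S)\<bar> * exp (- \<alpha> * quad (time_weight 1) a z) = 2 * (K * e z)" for z
      using K e_eq[of z] by (simp add: abs_mult)
    have "C2_derivs UNIV (\<lambda>z. c - h z) D D2"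
      using D(1) unfolding e_eq by (simp add: h_def diff_diff_eq2 algebra_simps)
    moreover have "space_part (D z) \<noteq> 0 \<and> D z (0, 1) < pq_op p q (D z) (D2 z)"
      if z: "z \<in> \<Theta>" "h z < K / 2" for z
    proof -
      note ne = geo(1)[OF z]
      have "K * e z * - (2 * \<alpha> * (snd z - snd a)) < K * e z * P z"
        using Ppos[OF z] Ke0[of z] by (intro mult_strict_left_mono) auto
      moreover have "pq_op p q (D z) (D2 z) = K * e z * P z"
        unfolding D(4)[OF ne] e_eq ab P_def by simp
      moreover have "D z (0, 1) = K * e z * - (2 * \<alpha> * (snd z - snd a))"
        unfolding D(3) e_eq by simp
      ultimately show ?thesis using D(2)[OF ne] by simp
    qed
    ultimately show "\<exists>D D2. C2_derivs UNIV (\<lambda>z. c - h z) D D2 \<and>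
      (\<forall>z\<in>\<Theta>. h z < K / 2 \<longrightarrow> space_part (D z) \<noteq> 0 \<and> D z (0, 1) < pq_op p q (D z) (D2 z))"
      by blast
  qed
qed

section \<open>From the barrier to convergence of the upper Perron solution\<close>

theorem lemma7p1:
  fixes p q R1 t0 t1 :: real
    and x0 x1 :: "real^'n"
    and \<Theta> :: "((real^'n) \<times> real) set"
  assumes "p > 1" and "q > 1"
    and "open \<Theta>" and "bounded \<Theta>"
    and "(x0, t0) \<in> frontier \<Theta>"
    and "(x1, t1) \<notin> \<Theta>" and "R1 > 0"
    and "ball (x1, t1) R1 \<inter> \<Theta> = {}"
    and "(x0, t0) \<in> frontier (ball (x1, t1) R1) \<inter> frontier \<Theta>"
    and "x1 \<noteq> x0"
  shows "regular_point p q \<Theta> (x0, t0)"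
proof -
  define z0 where "z0 = (x0, t0)"
  define z1 where "z1 = (x1, t1)"
  have z0: "z0 \<in> frontier \<Theta>" "ball z1 R1 \<inter> \<Theta> = {}" "fst z1 \<noteq> fst z0"
    using assms by (auto simp: z0_def z1_def)
  have R: "dist z1 z0 = R1" using assms by (auto simp: z0_def z1_def)
  have fc: "frontier \<Theta> \<subseteq> closure \<Theta>" by (simp add: frontier_def)
  have "(upper_Perron p q \<Theta> f \<longlongrightarrow> ereal (f z0)) (at z0 within \<Theta>)"
    if cf: "continuous_on (frontier \<Theta>) f" for f
  proof -
    have "compact (frontier \<Theta>)" using \<open>bounded \<Theta>\<close> by (rule compact_frontier_bounded)
    then have "bounded (f ` frontier \<Theta>)" using cf by (intro compact_imp_bounded compact_continuous_image)
    then obtain M where M: "M > 0" "\<And>\<xi>. \<xi> \<in> frontier \<Theta> \<Longrightarrow> \<bar>f \<xi>\<bar> \<le> M"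
      by (auto simp: bounded_pos)
    have f0: "\<bar>f z0\<bar> \<le> M" by (rule M(2)[OF z0(1)])
    \<comment> \<open>Since \<open>h\<close> is continuous and vanishes at \<open>z0\<close>, these
      bounds confine the limit at \<open>z0\<close> to within \<epsilon> of \<open>f z0\<close>, for
      every \<epsilon>.\<close>
    have key: "\<exists>h. continuous_on UNIV h \<and> h z0 = 0 \<and>
        (\<forall>z\<in>\<Theta>. ereal (f z0 - \<epsilon> - h z) \<le> upper_Perron p q \<Theta> f z \<and>
                upper_Perron p q \<Theta> f z \<le> ereal (f z0 + \<epsilon> + h z))"
      if \<epsilon>: "\<epsilon> > 0" for \<epsilon>
    proof -
      obtain r where r: "r > 0" "\<And>\<xi>. \<xi> \<in> frontier \<Theta> \<Longrightarrow> dist \<xi> z0 < r \<Longrightarrow> \<bar>f \<xi> - f z0\<bar> < \<epsilon>"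
        using cf z0(1) \<epsilon> unfolding continuous_on_iff dist_real_def by metis
      \<comment> \<open>With \<open>K = 4 * M\<close> the barrier is controlled up to height
        \<open>2 * M\<close>, which bounds the oscillation of \<open>f\<close>: where
        \<open>h\<close> is at least \<open>2 * M\<close>, \<open>f z0 + h\<close> is at least
        \<open>M\<close> and \<open>f z0 - h\<close> at most \<open>- M\<close>.\<close>
      have "4 * M > 0" using M by simp
      from exterior_ball_barrier[OF \<open>p > 1\<close> \<open>q > 1\<close> \<open>bounded \<Theta>\<close> z0(2) R z0(3) this r(1)]
      obtain h where h: "continuous_on UNIV h" "h z0 = 0"
        "\<And>z. z \<in> closure \<Theta> \<Longrightarrow> 0 \<le> h z"
        "\<And>z. z \<in> closure \<Theta> \<Longrightarrow> h z < 2 * M \<Longrightarrow> dist z z0 < r"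
        and upper: "\<And>c. \<exists>D D2. C2_derivs UNIV (\<lambda>z. c + h z) D D2 \<and>
          (\<forall>z\<in>\<Theta>. h z < 2 * M \<longrightarrow> space_part (D z) \<noteq> 0 \<and> pq_op p q (D z) (D2 z) \<le> D z (0, 1))"
        and lower: "\<And>c. \<exists>D D2. C2_derivs UNIV (\<lambda>z. c - h z) D D2 \<and>
          (\<forall>z\<in>\<Theta>. h z < 2 * M \<longrightarrow> space_part (D z) \<noteq> 0 \<and> D z (0, 1) < pq_op p q (D z) (D2 z))"
        by auto
      have hf: "\<bar>f \<xi> - f z0\<bar> < \<epsilon>" if "\<xi> \<in> frontier \<Theta>" "h \<xi> < 2 * M" for \<xi>
        using r(2) h(4) that fc by blast
      have "upper_Perron p q \<Theta> f z \<le> ereal (f z0 + \<epsilon> + h z)" if "z \<in> \<Theta>" for z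
      proof -
        define c where "c = f z0 + \<epsilon>"
        \<comment> \<open>The truncation is active exactly where \<open>h\<close> reaches
          \<open>2 * M\<close>, that is, where the differential inequality is no longer
          available.\<close>
        define w where "w z = min (c + h z) (c + 2 * M)" for z
        have "viscosity_supersolution p q \<Theta> (\<lambda>z. ereal (w z))"
          unfolding w_def using upper[of c]
          by (auto intro: viscosity_supersolution_min_const[OF \<open>p > 1\<close> \<open>open \<Theta>\<close>] simp del: ereal_min)
        moreover have "ereal c \<le> ereal (w z)" if "z \<in> \<Theta>" for z
          using h(3)[of z] that closure_subset[of \<Theta>] M(1) by (auto simp: w_def)
        moreover have "ereal (f \<xi>) \<le> Liminf (at \<xi> within \<Theta>) (\<lambda>z. ereal (w z))"
          if \<xi>: "\<xi> \<in> frontier \<Theta>" for \<xi>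
        proof -
          have "\<xi> islimpt \<Theta>"
            using \<xi> \<open>open \<Theta>\<close> by (auto simp: frontier_def closure_def interior_open)
          then have nt: "at \<xi> within \<Theta> \<noteq> bot" by (simp add: trivial_limit_within)
          have "continuous_on UNIV w" unfolding w_def by (intro continuous_intros h(1))
          then have "(w \<longlongrightarrow> w \<xi>) (at \<xi>)"
            unfolding continuous_on_eq_continuous_at[OF open_UNIV] isCont_def by blast
          then have "(w \<longlongrightarrow> w \<xi>) (at \<xi> within \<Theta>)" by (rule tendsto_within_subset) simp
          then have "((\<lambda>z. ereal (w z)) \<longlongrightarrow> ereal (w \<xi>)) (at \<xi> within \<Theta>)" by simp
          then have "Liminf (at \<xi> within \<Theta>) (\<lambda>z. ereal (w z)) = ereal (w \<xi>)"
            using nt by (intro lim_imp_Liminf)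
          moreover have "f \<xi> \<le> w \<xi>"
          proof (cases "h \<xi> < 2 * M")
            case True
            then show ?thesis using hf[OF \<xi> True] h(3)[of \<xi>] \<xi> fc by (auto simp: w_def c_def)
          next
            case False
            then show ?thesis using M(2)[OF \<xi>] f0 \<epsilon> by (auto simp: w_def c_def)
          qed
          ultimately show ?thesis by simp
        qed
        ultimately have "(\<lambda>z. ereal (w z)) \<in> upper_class p q \<Theta> f"
          unfolding upper_class_def by blast
        then have "upper_Perron p q \<Theta> f z \<le> ereal (w z)"
          unfolding upper_Perron_def by (rule INF_lower)
        also have "\<dots> \<le> ereal (f z0 + \<epsilon> + h z)" by (simp add: w_def c_def del: ereal_min)
        finally show ?thesis .
      qed
      moreover have "ereal (f z0 - \<epsilon> - h z) \<le> upper_Perron p q \<Theta> f z" if z: "z \<in> \<Theta>" for z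
        unfolding upper_Perron_def
      proof (rule INF_greatest)
        fix u assume "u \<in> upper_class p q \<Theta> f"
        then obtain m where u: "viscosity_supersolution p q \<Theta> u"
          and m: "\<And>z. z \<in> \<Theta> \<Longrightarrow> ereal m \<le> u z"
          and bdry: "\<And>\<xi>. \<xi> \<in> frontier \<Theta> \<Longrightarrow> ereal (f \<xi>) \<le> Liminf (at \<xi> within \<Theta>) u"
          by (auto simp: upper_class_def)
        \<comment> \<open>The lower barrier is a strict subsolution only where
          \<open>h < 2 * M\<close>. At the remaining points it lies below \<open>- M\<close>, and
          this bound places it below \<open>u\<close>.\<close>
        have uM: "ereal (- M) \<le> u y" if "y \<in> \<Theta>" for y
        proof (rule supersolution_minimum_principle[OF \<open>p > 1\<close> u \<open>open \<Theta>\<close> \<open>bounded \<Theta>\<close> m _ that])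
          fix \<xi> assume \<xi>: "\<xi> \<in> frontier \<Theta>"
          have "ereal (- M) \<le> ereal (f \<xi>)" using M(2)[OF \<xi>] by simp
          then show "ereal (- M) \<le> Liminf (at \<xi> within \<Theta>) u" using bdry[OF \<xi>] by (rule order_trans)
        qed
        obtain D D2 where C2: "C2_derivs UNIV (\<lambda>z. f z0 - \<epsilon> - h z) D D2" and
          sub: "\<And>z. z \<in> \<Theta> \<Longrightarrow> h z < 2 * M \<Longrightarrow>
            space_part (D z) \<noteq> 0 \<and> D z (0, 1) < pq_op p q (D z) (D2 z)"
          using lower[of "f z0 - \<epsilon>"] by blast
        show "ereal (f z0 - \<epsilon> - h z) \<le> u z"
        proof (rule comparison_with_strict_subsolution[OF u \<open>open \<Theta>\<close> \<open>bounded \<Theta>\<close> m C2 _ _ z])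
          fix \<xi> assume \<xi>: "\<xi> \<in> frontier \<Theta>"
          have "f z0 - \<epsilon> - h \<xi> \<le> f \<xi>"
          proof (cases "h \<xi> < 2 * M")
            case True
            then show ?thesis using hf[OF \<xi> True] h(3)[of \<xi>] \<xi> fc by auto
          next
            case False
            then show ?thesis using M(2)[OF \<xi>] f0 \<epsilon> by auto
          qed
          then have "ereal (f z0 - \<epsilon> - h \<xi>) \<le> ereal (f \<xi>)" by simp
          then show "ereal (f z0 - \<epsilon> - h \<xi>) \<le> Liminf (at \<xi> within \<Theta>) u"
            using bdry[OF \<xi>] by (rule order_trans)
        next
          fix y assume y: "y \<in> \<Theta>"
          show "ereal (f z0 - \<epsilon> - h y) \<le> u y \<or>
            space_part (D y) \<noteq> 0 \<and> D y (0, 1) < pq_op p q (D y) (D2 y)"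
          proof (cases "h y < 2 * M")
            case True
            then show ?thesis using sub[OF y] by blast
          next
            case False
            then have "ereal (f z0 - \<epsilon> - h y) \<le> ereal (- M)" using f0 \<epsilon> by simp
            then show ?thesis using uM[OF y] order_trans by blast
          qed
        qed
      qed
      ultimately show ?thesis using h(1,2) by blast
    qed
    have lim: "((\<lambda>z. c + s * h z) \<longlongrightarrow> c) (at z0 within \<Theta>)"
      if "continuous_on UNIV h" "h z0 = 0" for h :: "_ \<Rightarrow> real" and c s :: real
    proof -
      have "(h \<longlongrightarrow> h z0) (at z0)"
        using that(1) unfolding continuous_on_eq_continuous_at[OF open_UNIV] isCont_def by blast
      then have "(h \<longlongrightarrow> 0) (at z0 within \<Theta>)" using that(2) by (auto intro: tendsto_within_subset)
      then have "((\<lambda>z. c + s * h z) \<longlongrightarrow> c + s * 0) (at z0 within \<Theta>)" by (intro tendsto_intros)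
      then show ?thesis by simp
    qed
    have inT: "\<forall>\<^sub>F z in at z0 within \<Theta>. z \<in> \<Theta>" by (simp add: eventually_at_filter)
    show ?thesis
    proof (rule order_tendstoI)
      fix y assume "y < ereal (f z0)"
      then obtain s where s: "y < ereal s" "s < f z0" by (metis ereal_dense2 less_ereal.simps(1))
      define \<epsilon> where "\<epsilon> = (f z0 - s) / 2"
      have \<epsilon>: "\<epsilon> > 0" "s < f z0 - \<epsilon>" using s by (auto simp: \<epsilon>_def field_simps)
      from key[OF \<epsilon>(1)] obtain h where h: "continuous_on UNIV h" "h z0 = 0"
        "\<And>z. z \<in> \<Theta> \<Longrightarrow> ereal (f z0 - \<epsilon> - h z) \<le> upper_Perron p q \<Theta> f z" by blast
      have "\<forall>\<^sub>F z in at z0 within \<Theta>. s < (f z0 - \<epsilon>) + (- 1) * h z"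
        by (rule order_tendstoD(1)[OF lim[OF h(1,2)] \<epsilon>(2)])
      then show "\<forall>\<^sub>F z in at z0 within \<Theta>. y < upper_Perron p q \<Theta> f z"
        using inT
      proof eventually_elim
        case (elim z)
        have "y < ereal s" by (rule s)
        also have "\<dots> < ereal (f z0 - \<epsilon> - h z)" using elim by simp
        also have "\<dots> \<le> upper_Perron p q \<Theta> f z" using elim by (intro h)
        finally show ?case .
      qed
    next
      fix y assume "ereal (f z0) < y"
      then obtain s where s: "ereal s < y" "f z0 < s" by (metis ereal_dense2 less_ereal.simps(1))
      define \<epsilon> where "\<epsilon> = (s - f z0) / 2"
      have \<epsilon>: "\<epsilon> > 0" "f z0 + \<epsilon> < s" using s by (auto simp: \<epsilon>_def field_simps)
      from key[OF \<epsilon>(1)] obtain h where h: "continuous_on UNIV h" "h z0 = 0"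
        "\<And>z. z \<in> \<Theta> \<Longrightarrow> upper_Perron p q \<Theta> f z \<le> ereal (f z0 + \<epsilon> + h z)" by blast
      have "\<forall>\<^sub>F z in at z0 within \<Theta>. (f z0 + \<epsilon>) + 1 * h z < s"
        by (rule order_tendstoD(2)[OF lim[OF h(1,2)] \<epsilon>(2)])
      then show "\<forall>\<^sub>F z in at z0 within \<Theta>. upper_Perron p q \<Theta> f z < y"
        using inT
      proof eventually_elim
        case (elim z)
        have "upper_Perron p q \<Theta> f z \<le> ereal (f z0 + \<epsilon> + h z)" using elim by (intro h)
        also have "\<dots> < ereal s" using elim by simp
        also have "\<dots> < y" by (rule s)
        finally show ?case .
      qed
    qed
  qed
  then show ?thesis using z0(1) unfolding regular_point_def z0_def by blast
qed

end
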